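(* For all integers $n \geq 1$, \[ \overline{M}_{1}^{+}(n) > \overline{N}_{1}^{+}(n), \] where $\overline{N}_{1}^{+}(n) := \sum_{m=1}^{\infty} m\, \overline{N}(m,n)$ and $\overline{M}_{1}^{+}(n) := \sum_{m=1}^{\infty} m\, \overline{M}(m,n)$.
   Context: An overpartition of $n$ is a partition of $n$ (a non-increasing sequence of positive integers summing to $n$) in which the first occurrence of each distinct part size may be overlined. The rank of an overpartition is its largest part minus its number of parts; $\overline{N}(m,n)$ denotes the number of overpartitions of $n$ with rank $m$. For ordinary partitions, the crank numbers $M(m,n)$ are defined by the generating function $\sum_{n\ge 0}\sum_{m\in\mathbb{Z}} M(m,n) z^m q^n = \frac{(q;q)_\infty}{(zq;q)_\infty (q/z;q)_\infty}$ (for $n>1$, $M(m,n)$ is the number of partitions of $n$ whose crank is $m$, the crank being the largest part if 1 is not a part, and otherwise the number of parts larger than the number of 1's minus the number of 1's). The first residual crank of an overpartition is the crank of the subpartition formed by its non-overlined parts; accordingly the numbers $\overline{M}(m,n)$ are defined by \[ \sum_{n\ge 0}\sum_{m\in\mathbb{Z}} \overline{M}(m,n) z^m q^n = (-q;q)_\infty \frac{(q;q)_\infty}{(zq;q)_\infty (q/z;q)_\infty}. \] Here $(a;q)_n=\prod_{k=1}^{n}(1-aq^{k-1})$ for $n\in\mathbb{N}\cup\{\infty\}$, $(a;q)_0=1$. *)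

theory Defs
  imports
    "HOL-Analysis.Analysis"
    "HOL-Computational_Algebra.Formal_Laurent_Series"
begin

text \<open>
  An overpartition is a list of pairs (part, overlined?), with the parts in non-increasing order.
  An overlined entry must be the first occurrence of its part size.
\<close>

definition overpartition_of :: "nat \<Rightarrow> (nat \<times> bool) list \<Rightarrow> bool" where
  "overpartition_of n ps \<longleftrightarrow>
     sorted_wrt (\<ge>) (map fst ps) \<and>
     (\<forall>p\<in>set ps. fst p > 0) \<and>
     sum_list (map fst ps) = n \<and>
     (\<forall>i<length ps. snd (ps ! i) \<longrightarrow> (\<forall>j<i. fst (ps ! j) \<noteq> fst (ps ! i)))"

text \<open>The empty overpartition is given rank 0; it only occurs for \<open>n = 0\<close>.\<close>

definition overpartition_rank :: "(nat \<times> bool) list \<Rightarrow> int" where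
  "overpartition_rank ps =
     (if ps = [] then 0 else int (Max (fst ` set ps)) - int (length ps))"

definition Nbar :: "int \<Rightarrow> nat \<Rightarrow> nat" where
  "Nbar m n = card {ps. overpartition_of n ps \<and> overpartition_rank ps = m}"

text \<open>
  Identities in \<open>z\<close> and \<open>q\<close> are read as formal power series in \<open>q\<close> whose coefficients are
  formal Laurent series in \<open>z\<close>. Infinite products converge in the \<open>q\<close>-adic topology, and
  quotients with unit denominator are expanded in powers of \<open>q\<close>. The coefficients of \<open>z\<^sup>m q\<^sup>n\<close>
  below are integers; \<open>real\<close> serves only to make division available.
\<close>

type_synonym zq_series = "real fls fps"

abbreviation q_var :: zq_series where "q_var \<equiv> fps_X"

abbreviation z_var :: zq_series where "z_var \<equiv> fps_const fls_X"

abbreviation z_var_inv :: zq_series where "z_var_inv \<equiv> fps_const fls_X_inv"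

definition qpoch_inf :: "zq_series \<Rightarrow> zq_series" where
  "qpoch_inf a = prodinf (\<lambda>k. 1 - a * q_var ^ k)"

definition crank_gf :: zq_series where
  "crank_gf = qpoch_inf q_var / (qpoch_inf (z_var * q_var) * qpoch_inf (z_var_inv * q_var))"

definition residual_crank_gf :: zq_series where
  "residual_crank_gf = qpoch_inf (- q_var) * crank_gf"

definition Mbar :: "int \<Rightarrow> nat \<Rightarrow> real" where
  "Mbar m n = fls_nth (fps_nth residual_crank_gf n) m"

text \<open>
  For fixed \<open>n\<close>, both \<open>Nbar m n\<close> and \<open>Mbar m n\<close> vanish for all but finitely many \<open>m\<close>,
  so these infinite sums have finite support.
\<close>

definition Nbar1_plus :: "nat \<Rightarrow> real" where
  "Nbar1_plus n = (\<Sum>\<^sub>\<infinity>m\<in>{1::int..}. of_int m * real (Nbar m n))"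

definition Mbar1_plus :: "nat \<Rightarrow> real" where
  "Mbar1_plus n = (\<Sum>\<^sub>\<infinity>m\<in>{1::int..}. of_int m * Mbar m n)"

end

theory Submission
  imports Defs "HOL-Library.Nat_Bijection"
begin

text \<open>
  Let all products be infinite and \<open>P(z) = 1 / ((zq;q)(q/z;q))\<close>. Since
  \<open>1 - z\<^sup>2 q\<^sup>2\<^sup>k = (1 - z q\<^sup>k)(1 + z q\<^sup>k)\<close>, we have \<open>P(z) = Y(z\<^sup>2) S(z)\<close> with
  \<open>Y(z) = 1 / ((zq\<^sup>2;q\<^sup>2)(q\<^sup>2/z;q\<^sup>2))\<close> and \<open>S(z) = (-zq;q)(-q/z;q)\<close>. The positive crank moment is
  \<open>(q\<^sup>2;q\<^sup>2)\<close> times the positive moment of \<open>P\<close>, that is, of a sum \<open>2Y + S\<close> of symmetric variables.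
  A recurrence for overpartitions of rank at least \<open>k\<close> in the style of Dyson's adjoint, compared
  with the analogous recurrence for the tail sums of the coefficients of \<open>Y\<close>, shows that the
  positive rank moment is the same expression with \<open>2Y + S\<close> replaced by \<open>2Y\<close>. Averaging
  \<open>\<bar>2Y + S\<bar> - \<bar>2Y\<bar>\<close> over the sign of \<open>S\<close> leaves \<open>max 0 (\<bar>S\<bar> - 2\<bar>Y\<bar>)\<close>, so the difference of the
  two moments is a combination, with nonnegative coefficients, of weighted tail sums of the
  coefficients of \<open>S\<close>. By the Jacobi triple product, adjacent coefficients of \<open>(q;q) S\<close> add up to
  powers of \<open>q\<close> with triangular exponents, and this makes these tail sums nonnegative.
\<close>

section \<open>Locally finite sums of power series\<close>

definition locfin :: "('i \<Rightarrow> 'a::zero fps) \<Rightarrow> 'i set \<Rightarrow> bool" where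
  "locfin f I \<longleftrightarrow> (\<forall>n. finite {i\<in>I. fps_nth (f i) n \<noteq> 0})"

definition fsum :: "('i \<Rightarrow> 'a::comm_ring_1 fps) \<Rightarrow> 'i set \<Rightarrow> 'a fps" where
  "fsum f I = Abs_fps (\<lambda>n. \<Sum>i\<in>{i\<in>I. fps_nth (f i) n \<noteq> 0}. fps_nth (f i) n)"

lemma locfinD: "locfin f I \<Longrightarrow> finite {i\<in>I. fps_nth (f i) n \<noteq> 0}"
  by (simp add: locfin_def)

lemma locfinI:
  assumes "\<And>n. finite {i\<in>I. h i \<le> (n::nat)}"
    and "\<And>i n. i \<in> I \<Longrightarrow> n < h i \<Longrightarrow> fps_nth (f i) n = 0"
  shows "locfin f I"
  unfolding locfin_def
proof
  fix n
  have "{i\<in>I. fps_nth (f i) n \<noteq> 0} \<subseteq> {i\<in>I. h i \<le> n}"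
    using assms(2) by (auto simp: not_less[symmetric])
  then show "finite {i\<in>I. fps_nth (f i) n \<noteq> 0}"
    using assms(1) finite_subset by blast
qed

lemma locfin_subset: "locfin f I \<Longrightarrow> J \<subseteq> I \<Longrightarrow> locfin f J"
  unfolding locfin_def by (auto intro: finite_subset[rotated])

lemma fsum_nth:
  assumes "finite J" "J \<subseteq> I" "\<And>i. i \<in> I - J \<Longrightarrow> fps_nth (f i) n = 0"
  shows "fps_nth (fsum f I) n = (\<Sum>i\<in>J. fps_nth (f i) n)"
  unfolding fsum_def fps_nth_Abs_fps
  by (rule sum.mono_neutral_left) (use assms in auto)

lemma fsum_nth_support:
  "fps_nth (fsum f I) n = (\<Sum>i\<in>{i\<in>I. fps_nth (f i) n \<noteq> 0}. fps_nth (f i) n)"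
  by (simp add: fsum_def)

lemma fsum_cong: "I = J \<Longrightarrow> (\<And>i. i \<in> J \<Longrightarrow> f i = g i) \<Longrightarrow> fsum f I = fsum g J"
  by (auto simp: fsum_def fps_eq_iff intro!: sum.cong)

lemma fsum_finite: "finite I \<Longrightarrow> fsum f I = sum f I"
  by (rule fps_ext) (subst fsum_nth[of I], auto simp: fps_sum_nth)

lemma locfin_add:
  assumes "locfin f I" "locfin g I"
  shows "locfin (\<lambda>i. f i + g i :: 'a::comm_ring_1 fps) I"
  unfolding locfin_def
proof
  fix n
  have "{i\<in>I. fps_nth (f i + g i) n \<noteq> 0} \<subseteq> {i\<in>I. fps_nth (f i) n \<noteq> 0} \<union> {i\<in>I. fps_nth (g i) n \<noteq> 0}"
    by auto
  then show "finite {i\<in>I. fps_nth (f i + g i) n \<noteq> 0}"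
    by (rule finite_subset) (use assms in \<open>auto dest: locfinD\<close>)
qed

lemma fsum_add:
  assumes "locfin f I" "locfin g I"
  shows "fsum (\<lambda>i. f i + g i) I = fsum f I + fsum g I"
proof (rule fps_ext)
  fix n
  let ?J = "{i\<in>I. fps_nth (f i) n \<noteq> 0} \<union> {i\<in>I. fps_nth (g i) n \<noteq> 0}"
  have J: "finite ?J" "?J \<subseteq> I" using assms by (auto dest: locfinD)
  show "fps_nth (fsum (\<lambda>i. f i + g i) I) n = fps_nth (fsum f I + fsum g I) n"
    unfolding fps_add_nth
    by (subst (1 2 3) fsum_nth[OF J]) (auto simp: sum.distrib)
qed

lemma fps_mult_nth_nonzeroE:
  fixes f :: "'a::comm_ring_1 fps"
  assumes "fps_nth (f * g) n \<noteq> 0"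
  obtains k where "k \<le> n" "fps_nth f k \<noteq> 0" "fps_nth g (n - k) \<noteq> 0"
proof -
  from assms obtain k where "k \<in> {0..n}" "fps_nth f k * fps_nth g (n - k) \<noteq> 0"
    unfolding fps_mult_nth by (rule sum.not_neutral_contains_not_neutral)
  then show ?thesis by (intro that[of k]) auto
qed

lemma locfin_mult_left:
  assumes "locfin f I"
  shows "locfin (\<lambda>i. c * f i :: 'a::comm_ring_1 fps) I"
  unfolding locfin_def
proof
  fix n
  have "{i\<in>I. fps_nth (c * f i) n \<noteq> 0} \<subseteq> (\<Union>k\<le>n. {i\<in>I. fps_nth (f i) k \<noteq> 0})"
  proof
    fix i assume i: "i \<in> {i\<in>I. fps_nth (c * f i) n \<noteq> 0}"
    then obtain k where "k \<le> n" "fps_nth c k \<noteq> 0" "fps_nth (f i) (n - k) \<noteq> 0"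
      using fps_mult_nth_nonzeroE by blast
    then have "n - k \<in> {..n}" "fps_nth (f i) (n - k) \<noteq> 0" by auto
    with i show "i \<in> (\<Union>k\<le>n. {i\<in>I. fps_nth (f i) k \<noteq> 0})" by blast
  qed
  then show "finite {i\<in>I. fps_nth (c * f i) n \<noteq> 0}"
    by (rule finite_subset) (use assms in \<open>auto dest: locfinD\<close>)
qed

lemma fsum_mult_left:
  assumes "locfin f I"
  shows "fsum (\<lambda>i. c * f i) I = c * fsum f I"
proof (rule fps_ext)
  fix n
  let ?J = "\<Union>k\<le>n. {i\<in>I. fps_nth (f i) k \<noteq> 0}"
  have J: "finite ?J" "?J \<subseteq> I" using assms by (auto dest: locfinD)
  have z: "fps_nth (f i) k = 0" if "i \<in> I - ?J" "k \<le> n" for i k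
    using that by auto
  have "fps_nth (c * f i) n = 0" if "i \<in> I - ?J" for i
    unfolding fps_mult_nth by (rule sum.neutral) (use z[OF that] in auto)
  then have "fps_nth (fsum (\<lambda>i. c * f i) I) n = (\<Sum>i\<in>?J. fps_nth (c * f i) n)"
    by (rule fsum_nth[OF J])
  also have "\<dots> = (\<Sum>k=0..n. fps_nth c k * (\<Sum>i\<in>?J. fps_nth (f i) (n - k)))"
    unfolding fps_mult_nth by (subst sum.swap) (simp add: sum_distrib_left)
  also have "\<dots> = (\<Sum>k=0..n. fps_nth c k * fps_nth (fsum f I) (n - k))"
    by (intro sum.cong refl arg_cong2[where f = times] fsum_nth[OF J, symmetric] z) auto
  finally show "fps_nth (fsum (\<lambda>i. c * f i) I) n = fps_nth (c * fsum f I) n"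
    by (simp add: fps_mult_nth)
qed

lemma fsum_mult_right: "locfin f I \<Longrightarrow> fsum (\<lambda>i. f i * c) I = fsum f I * c"
  using fsum_mult_left[of f I c] by (simp add: mult.commute)

lemma locfin_uminus: "locfin f I \<Longrightarrow> locfin (\<lambda>i. - f i :: 'a::comm_ring_1 fps) I"
  by (simp add: locfin_def)

lemma fsum_uminus: "fsum (\<lambda>i. - f i) I = - fsum f I"
  by (auto simp: fsum_def fps_eq_iff sum_negf)

lemma locfin_diff: "locfin f I \<Longrightarrow> locfin g I \<Longrightarrow> locfin (\<lambda>i. f i - g i :: 'a::comm_ring_1 fps) I"
  using locfin_add[of f I "\<lambda>i. - g i"] locfin_uminus[of g I] by simp

lemma fsum_diff:
  "locfin f I \<Longrightarrow> locfin g I \<Longrightarrow> fsum (\<lambda>i. f i - g i) I = fsum f I - fsum g I"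
  using fsum_add[of f I "\<lambda>i. - g i"] locfin_uminus[of g I] by (simp add: fsum_uminus)

lemma locfin_reindex:
  assumes "inj_on h I"
  shows "locfin f (h ` I) \<longleftrightarrow> locfin (\<lambda>i. f (h i)) I"
proof -
  have "{j \<in> h ` I. fps_nth (f j) n \<noteq> 0} = h ` {i\<in>I. fps_nth (f (h i)) n \<noteq> 0}" for n by auto
  moreover have "inj_on h {i\<in>I. fps_nth (f (h i)) n \<noteq> 0}" for n
    using assms by (rule inj_on_subset) auto
  ultimately show ?thesis by (simp add: locfin_def finite_image_iff)
qed

lemma fsum_reindex:
  assumes "inj_on h I"
  shows "fsum f (h ` I) = fsum (\<lambda>i. f (h i)) I"
proof (rule fps_ext)
  fix n
  have "{j \<in> h ` I. fps_nth (f j) n \<noteq> 0} = h ` {i\<in>I. fps_nth (f (h i)) n \<noteq> 0}" by auto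
  moreover have "inj_on h {i\<in>I. fps_nth (f (h i)) n \<noteq> 0}"
    using assms by (rule inj_on_subset) auto
  ultimately show "fps_nth (fsum f (h ` I)) n = fps_nth (fsum (\<lambda>i. f (h i)) I) n"
    by (simp add: fsum_nth_support sum.reindex)
qed

lemma locfin_Sigma_inner:
  assumes "locfin (\<lambda>(i,j). f i j) (Sigma I J)" "i \<in> I"
  shows "locfin (f i) (J i)"
  unfolding locfin_def
proof
  fix n
  have "Pair i ` {j\<in>J i. fps_nth (f i j) n \<noteq> 0} \<subseteq> {p\<in>Sigma I J. fps_nth (case p of (i,j) \<Rightarrow> f i j) n \<noteq> 0}"
    using assms(2) by auto
  then have "finite (Pair i ` {j\<in>J i. fps_nth (f i j) n \<noteq> 0})"
    using locfinD[OF assms(1)] finite_subset by blast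
  then show "finite {j\<in>J i. fps_nth (f i j) n \<noteq> 0}"
    by (rule finite_imageD) (auto simp: inj_on_def)
qed

lemma locfin_Sigma_outer:
  assumes "locfin (\<lambda>(i,j). f i j) (Sigma I J)"
  shows "locfin (\<lambda>i. fsum (f i) (J i)) I"
  unfolding locfin_def
proof
  fix n
  have "{i\<in>I. fps_nth (fsum (f i) (J i)) n \<noteq> 0} \<subseteq> fst ` {p\<in>Sigma I J. fps_nth (case p of (i,j) \<Rightarrow> f i j) n \<noteq> 0}"
  proof
    fix i assume i: "i \<in> {i\<in>I. fps_nth (fsum (f i) (J i)) n \<noteq> 0}"
    then obtain j where "j \<in> J i" "fps_nth (f i j) n \<noteq> 0"
      unfolding fsum_nth_support by (auto elim!: sum.not_neutral_contains_not_neutral)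
    with i show "i \<in> fst ` {p\<in>Sigma I J. fps_nth (case p of (i,j) \<Rightarrow> f i j) n \<noteq> 0}"
      by (force simp: image_iff)
  qed
  then show "finite {i\<in>I. fps_nth (fsum (f i) (J i)) n \<noteq> 0}"
    by (rule finite_subset) (intro finite_imageI locfinD[OF assms])
qed

lemma fsum_Sigma:
  assumes "locfin (\<lambda>(i,j). f i j) (Sigma I J)"
  shows "fsum (\<lambda>(i,j). f i j) (Sigma I J) = fsum (\<lambda>i. fsum (f i) (J i)) I"
proof (rule fps_ext)
  fix n
  define S where "S = {p\<in>Sigma I J. fps_nth (case p of (i,j) \<Rightarrow> f i j) n \<noteq> 0}"
  have S: "finite S" unfolding S_def by (rule locfinD[OF assms])
  define K where "K i = {j\<in>J i. fps_nth (f i j) n \<noteq> 0}" for i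
  have finK: "finite (K i)" if "i \<in> I" for i
    unfolding K_def by (rule locfinD[OF locfin_Sigma_inner[OF assms that]])
  have SK: "S = Sigma (fst ` S) K" unfolding S_def K_def by force
  have sub: "fst ` S \<subseteq> I" unfolding S_def by auto
  have "fps_nth (fsum (\<lambda>(i,j). f i j) (Sigma I J)) n = (\<Sum>(i,j)\<in>S. fps_nth (f i j) n)"
    unfolding fsum_nth_support S_def[symmetric] by (auto intro: sum.cong)
  also have "\<dots> = (\<Sum>i\<in>fst ` S. \<Sum>j\<in>K i. fps_nth (f i j) n)"
    by (subst (1) SK, rule sum.Sigma[symmetric]) (use S finK sub in auto)
  also have "\<dots> = (\<Sum>i\<in>fst ` S. fps_nth (fsum (f i) (J i)) n)"
    by (simp add: fsum_nth_support K_def)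
  also have "\<dots> = fps_nth (fsum (\<lambda>i. fsum (f i) (J i)) I) n"
  proof (rule fsum_nth[symmetric])
    fix i assume i: "i \<in> I - fst ` S"
    then have "K i = {}" unfolding K_def S_def by (force simp: image_iff)
    then show "fps_nth (fsum (f i) (J i)) n = 0" by (simp only: fsum_nth_support K_def[symmetric] sum.empty)
  qed (use S sub in auto)
  finally show "fps_nth (fsum (\<lambda>(i,j). f i j) (Sigma I J)) n = fps_nth (fsum (\<lambda>i. fsum (f i) (J i)) I) n" .
qed

lemma locfin_prod:
  fixes f :: "'i \<Rightarrow> 'a::comm_ring_1 fps"
  assumes "locfin f I" "locfin g J"
  shows "locfin (\<lambda>(i,j). f i * g j) (I \<times> J)"
  unfolding locfin_def
proof
  fix n
  have "{p\<in>I \<times> J. fps_nth (case p of (i,j) \<Rightarrow> f i * g j) n \<noteq> 0} \<subseteq>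
     (\<Union>k\<le>n. {i\<in>I. fps_nth (f i) k \<noteq> 0}) \<times> (\<Union>k\<le>n. {i\<in>J. fps_nth (g i) k \<noteq> 0})"
  proof
    fix p assume "p \<in> {p\<in>I \<times> J. fps_nth (case p of (i,j) \<Rightarrow> f i * g j) n \<noteq> 0}"
    then obtain i j where p: "p = (i, j)" "i \<in> I" "j \<in> J" "fps_nth (f i * g j) n \<noteq> 0" by auto
    then obtain k where "k \<le> n" "fps_nth (f i) k \<noteq> 0" "fps_nth (g j) (n - k) \<noteq> 0"
      using fps_mult_nth_nonzeroE by blast
    moreover from this have "n - k \<in> {..n}" by simp
    ultimately show "p \<in> (\<Union>k\<le>n. {i\<in>I. fps_nth (f i) k \<noteq> 0}) \<times> (\<Union>k\<le>n. {i\<in>J. fps_nth (g i) k \<noteq> 0})"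
      using p by blast
  qed
  then show "finite {p\<in>I \<times> J. fps_nth (case p of (i,j) \<Rightarrow> f i * g j) n \<noteq> 0}"
    by (rule finite_subset) (use assms in \<open>auto dest: locfinD\<close>)
qed

lemma fsum_prod:
  assumes "locfin f I" "locfin g J"
  shows "fsum (\<lambda>(i,j). f i * g j) (I \<times> J) = fsum f I * fsum g J"
proof -
  have "fsum (\<lambda>(i,j). f i * g j) (I \<times> J) = fsum (\<lambda>i. fsum (\<lambda>j. f i * g j) J) I"
    by (rule fsum_Sigma[OF locfin_prod[OF assms]])
  also have "\<dots> = fsum (\<lambda>i. f i * fsum g J) I"
    by (intro fsum_cong refl fsum_mult_left assms)
  finally show ?thesis by (simp add: fsum_mult_right assms)
qed

lemma fsum_Un_disjoint:
  assumes "locfin f (I \<union> J)" "I \<inter> J = {}"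
  shows "fsum f (I \<union> J) = fsum f I + fsum f J"
proof (rule fps_ext)
  fix n
  have "{i\<in>I \<union> J. fps_nth (f i) n \<noteq> 0} = {i\<in>I. fps_nth (f i) n \<noteq> 0} \<union> {i\<in>J. fps_nth (f i) n \<noteq> 0}" by auto
  moreover have "finite {i\<in>I. fps_nth (f i) n \<noteq> 0}" "finite {i\<in>J. fps_nth (f i) n \<noteq> 0}"
    using assms(1) by (auto intro!: locfinD intro: locfin_subset)
  ultimately show "fps_nth (fsum f (I \<union> J)) n = fps_nth (fsum f I + fsum f J) n"
    using assms(2) by (simp add: fsum_nth_support) (subst sum.union_disjoint, auto)
qed

lemma fsum_zero_outside:
  assumes "J \<subseteq> I" "\<And>i. i \<in> I - J \<Longrightarrow> f i = 0"
  shows "fsum f I = fsum f J"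
proof -
  have "{i\<in>I. fps_nth (f i) n \<noteq> 0} = {i\<in>J. fps_nth (f i) n \<noteq> 0}" for n using assms by force
  then show ?thesis by (simp add: fsum_def)
qed

lemma fsum_nonneg:
  fixes f :: "'i \<Rightarrow> real fps"
  assumes "\<And>i. i \<in> I \<Longrightarrow> fps_nth (f i) n \<ge> 0"
  shows "fps_nth (fsum f I) n \<ge> 0"
  unfolding fsum_nth_support using assms by (auto intro: sum_nonneg)

lemma fsum_nat_split:
  fixes f :: "nat \<Rightarrow> 'a::comm_ring_1 fps"
  assumes "locfin f UNIV"
  shows "fsum f UNIV = f 0 + fsum (\<lambda>i. f (Suc i)) UNIV"
proof -
  have U: "UNIV = {0::nat} \<union> Suc ` UNIV" by (auto simp: image_iff) (metis not0_implies_Suc)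
  have "fsum f UNIV = fsum f {0} + fsum f (Suc ` UNIV)"
    by (subst U, rule fsum_Un_disjoint) (use assms in \<open>auto intro: locfin_subset\<close>)
  then show ?thesis by (simp add: fsum_finite fsum_reindex)
qed

lemma locfin_nat_shift:
  fixes f :: "nat \<Rightarrow> 'a::comm_ring_1 fps"
  shows "locfin f UNIV \<Longrightarrow> locfin (\<lambda>i. f (i + k)) UNIV"
  using locfin_reindex[of "\<lambda>i. i + k" UNIV f] by (auto intro: locfin_subset simp: inj_on_def)

section \<open>Infinite products and their coefficients\<close>

lemma fps_mult_nth_cong:
  assumes "\<And>i. i \<le> n \<Longrightarrow> fps_nth f i = fps_nth f' i" "\<And>i. i \<le> n \<Longrightarrow> fps_nth g i = fps_nth g' i"
  shows "fps_nth (f * g) n = fps_nth (f' * g') n"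
  using assms by (simp add: fps_mult_nth)

lemma fps_prod_nth_stable:
  fixes f :: "nat \<Rightarrow> 'a::comm_ring_1 fps"
  assumes "\<And>k i. i \<le> k \<Longrightarrow> fps_nth (f k) i = fps_nth 1 i" "n \<le> M" "n \<le> N"
  shows "fps_nth (\<Prod>k<M. f k) n = fps_nth (\<Prod>k<N. f k) n"
proof -
  have "fps_nth (\<Prod>k<n+d. f k) n = fps_nth (\<Prod>k<n. f k) n" for d
  proof (induction d)
    case (Suc d)
    have "fps_nth ((\<Prod>k<n+d. f k) * f (n+d)) n = fps_nth ((\<Prod>k<n+d. f k) * 1) n"
      by (rule fps_mult_nth_cong) (use assms(1) in auto)
    with Suc show ?case by simp
  qed simp
  from this[of "M - n"] this[of "N - n"] assms(2,3) show ?thesis by simp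
qed

lemma fps_prodinf_nth:
  fixes f :: "nat \<Rightarrow> 'a::idom fps"
  assumes f: "\<And>k i. i \<le> k \<Longrightarrow> fps_nth (f k) i = fps_nth 1 i"
    and "n \<le> M"
  shows "fps_nth (prodinf f) n = fps_nth (\<Prod>k<M. f k) n"
proof -
  define p where "p = Abs_fps (\<lambda>n. fps_nth (\<Prod>k<n. f k) n)"
  have p: "fps_nth p n = fps_nth (\<Prod>k<M. f k) n" if "n \<le> M" for n M
    unfolding p_def fps_nth_Abs_fps by (rule fps_prod_nth_stable[OF f]) (use that in auto)
  have "(\<lambda>n. \<Prod>i\<le>n. f i) \<longlonglongrightarrow> p"
  proof (rule tendsto_fpsI)
    fix n
    show "\<forall>\<^sub>F x in sequentially. fps_nth (\<Prod>i\<le>x. f i) n = fps_nth p n"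
      using eventually_ge_at_top[of n]
      by eventually_elim (simp only: lessThan_Suc_atMost[symmetric] p[OF le_SucI])
  qed
  moreover have "fps_nth p 0 = 1" by (simp add: p_def)
  then have "p \<noteq> 0" by auto
  ultimately have "f has_prod p" by (auto simp: has_prod_def raw_has_prod_def)
  then have "prodinf f = p" by (metis has_prod_unique)
  with p assms(2) show ?thesis by simp
qed

lemma fps_prodinf_mult:
  fixes f g :: "nat \<Rightarrow> 'a::idom fps"
  assumes "\<And>k i. i \<le> k \<Longrightarrow> fps_nth (f k) i = fps_nth 1 i"
    and "\<And>k i. i \<le> k \<Longrightarrow> fps_nth (g k) i = fps_nth 1 i"
  shows "prodinf (\<lambda>k. f k * g k) = prodinf f * prodinf g"
proof (rule fps_ext)
  fix n
  have fg: "fps_nth (f k * g k) i = fps_nth 1 i" if "i \<le> k" for i k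
    using fps_mult_nth_cong[where f = "f k" and f' = 1 and g = "g k" and g' = 1 and n = i] assms that by auto
  have "fps_nth (prodinf (\<lambda>k. f k * g k)) n = fps_nth ((\<Prod>k<n. f k) * (\<Prod>k<n. g k)) n"
    by (subst fps_prodinf_nth[OF fg, where n = n and M = n]) (auto simp: prod.distrib)
  also have "\<dots> = fps_nth (prodinf f * prodinf g) n"
    by (rule fps_mult_nth_cong) (use assms in \<open>auto simp: fps_prodinf_nth\<close>)
  finally show "fps_nth (prodinf (\<lambda>k. f k * g k)) n = fps_nth (prodinf f * prodinf g) n" .
qed

lemma fps_inverse_nth_cong:
  fixes f g :: "'a::field fps"
  assumes "\<And>i. i \<le> n \<Longrightarrow> fps_nth f i = fps_nth g i" "fps_nth f 0 \<noteq> 0"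
  shows "fps_nth (inverse f) n = fps_nth (inverse g) n"
proof -
  have g0: "fps_nth g 0 \<noteq> 0" using assms by (metis le0)
  have "inverse f = (inverse f * inverse g) * g"
    using inverse_mult_eq_1[OF g0] by (simp add: mult.assoc)
  moreover have "inverse g = (inverse f * inverse g) * f"
    using inverse_mult_eq_1[OF assms(2)] by (simp add: mult_ac)
  moreover have "fps_nth ((inverse f * inverse g) * g) n = fps_nth ((inverse f * inverse g) * f) n"
    by (rule fps_mult_nth_cong) (use assms in auto)
  ultimately show ?thesis by metis
qed

definition qfac :: "nat \<Rightarrow> nat \<Rightarrow> real fps" where
  "qfac m a = (\<Prod>k<a. 1 - fps_X ^ (m * Suc k))"

definition qinf :: "nat \<Rightarrow> real fps" where
  "qinf m = prodinf (\<lambda>k. 1 - fps_X ^ (m * Suc k))"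

definition pinf :: "real fps" where
  "pinf = prodinf (\<lambda>k. 1 + fps_X ^ Suc k)"

abbreviation iqf :: "nat \<Rightarrow> nat \<Rightarrow> real fps" where "iqf m a \<equiv> inverse (qfac m a)"

text \<open>By Euler, \<open>ecf m a\<close> is the coefficient of \<open>z\<^sup>a\<close> in \<open>1 / (zq\<^sup>m;q\<^sup>m)\<close> and \<open>scf r\<close> is the coefficient of
  \<open>z\<^sup>r\<close> in \<open>(-zq;q)\<close>.\<close>

definition ecf :: "nat \<Rightarrow> nat \<Rightarrow> real fps" where
  "ecf m a = fps_X ^ (m * a) * iqf m a"

definition scf :: "nat \<Rightarrow> real fps" where
  "scf r = fps_X ^ triangle r * iqf 1 r"

lemma one_minus_X_nth:
  assumes "m \<ge> 1" "i \<le> k"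
  shows "fps_nth (1 - fps_X ^ (m * Suc k) :: real fps) i = fps_nth 1 i"
proof -
  have "m * Suc k \<ge> 1 * Suc k" using assms by (intro mult_mono) auto
  then show ?thesis using assms by (simp add: fps_X_power_nth)
qed

lemma qfac_0 [simp]: "qfac m 0 = 1" by (simp add: qfac_def)

lemma qfac_nth_0 [simp]: "m \<ge> 1 \<Longrightarrow> fps_nth (qfac m a) 0 = 1"
  by (induction a) (auto simp: qfac_def fps_X_power_nth simp del: power_Suc)

lemma qfac_mult_iqf: "m \<ge> 1 \<Longrightarrow> qfac m a * iqf m a = 1"
  by (rule inverse_mult_eq_1') simp

lemma iqf_Suc:
  assumes "m \<ge> 1"
  shows "(1 - fps_X ^ (m * Suc a)) * iqf m (Suc a) = iqf m a"
proof -
  have "(1 - fps_X ^ (m * Suc a)) * iqf m (Suc a) = iqf m a * (qfac m (Suc a) * iqf m (Suc a))"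
    using qfac_mult_iqf[OF assms, of a] by (simp add: qfac_def mult_ac)
  then show ?thesis by (simp only: qfac_mult_iqf[OF assms] mult_1_right)
qed

lemma qinf_nth: "m \<ge> 1 \<Longrightarrow> n \<le> M \<Longrightarrow> fps_nth (qinf m) n = fps_nth (qfac m M) n"
  unfolding qinf_def qfac_def by (rule fps_prodinf_nth) (rule one_minus_X_nth)

lemma qinf_nth_0 [simp]: "m \<ge> 1 \<Longrightarrow> fps_nth (qinf m) 0 = 1"
  using qinf_nth[of m 0 0] by simp

lemma iqf_nth_inf: "m \<ge> 1 \<Longrightarrow> n \<le> M \<Longrightarrow> fps_nth (iqf m M) n = fps_nth (inverse (qinf m)) n"
  by (rule fps_inverse_nth_cong) (auto simp: qinf_nth[of m _ M])

lemma one_plus_X_nth: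
  "i \<le> k \<Longrightarrow> fps_nth (1 + fps_X ^ Suc k :: real fps) i = fps_nth 1 i"
  by (simp add: fps_X_power_nth del: power_Suc)

lemma pinf_nth: "n \<le> M \<Longrightarrow> fps_nth pinf n = fps_nth (\<Prod>k<M. 1 + fps_X ^ Suc k) n"
  unfolding pinf_def by (rule fps_prodinf_nth) (rule one_plus_X_nth)

lemma qinf_2: "qinf 2 = pinf * qinf 1"
proof -
  have "(1 + fps_X ^ Suc k) * (1 - fps_X ^ (1 * Suc k)) = (1 - fps_X ^ (2 * Suc k) :: real fps)" for k
    by (simp only: mult_2 power_add mult_1) (simp add: algebra_simps)
  then have "qinf 2 = prodinf (\<lambda>k. (1 + fps_X ^ Suc k) * (1 - fps_X ^ (1 * Suc k)))"
    by (simp only: qinf_def)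
  also have "\<dots> = pinf * qinf 1"
    unfolding pinf_def qinf_def
    by (rule fps_prodinf_mult) (simp_all only: one_plus_X_nth one_minus_X_nth order_refl)
  finally show ?thesis .
qed

lemma ecf_0 [simp]: "ecf m 0 = 1" by (simp add: ecf_def)

lemma ecf_nth_eq_0: "m \<ge> 1 \<Longrightarrow> n < a \<Longrightarrow> fps_nth (ecf m a) n = 0"
  unfolding ecf_def fps_X_power_mult_nth by (cases m) auto

lemma triangle_ge: "n \<le> triangle n" by (induction n) auto

lemma scf_0 [simp]: "scf 0 = 1" by (simp add: scf_def)

lemma scf_nth_eq_0: "n < r \<Longrightarrow> fps_nth (scf r) n = 0"
  unfolding scf_def fps_X_power_mult_nth using triangle_ge[of r] by simp

lemma ecf_Suc: "m \<ge> 1 \<Longrightarrow> (1 - fps_X ^ (m * Suc a)) * ecf m (Suc a) = fps_X ^ m * ecf m a"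
proof -
  assume m: "m \<ge> 1"
  have "(1 - fps_X ^ (m * Suc a)) * ecf m (Suc a)
      = fps_X ^ (m * Suc a) * ((1 - fps_X ^ (m * Suc a)) * iqf m (Suc a))"
    by (simp only: ecf_def mult.left_commute)
  also have "\<dots> = fps_X ^ m * ecf m a"
    unfolding iqf_Suc[OF m] by (simp only: ecf_def mult_Suc_right power_add mult.assoc)
  finally show ?thesis .
qed

lemma scf_Suc: "(1 - fps_X ^ Suc r) * scf (Suc r) = fps_X ^ Suc r * scf r"
proof -
  have "(1 - fps_X ^ Suc r) * scf (Suc r)
      = fps_X ^ (triangle (Suc r)) * ((1 - fps_X ^ (1 * Suc r)) * iqf 1 (Suc r))"
    by (simp only: scf_def mult.left_commute mult_1)
  also have "\<dots> = fps_X ^ Suc r * scf r"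
    unfolding iqf_Suc[OF order_refl] by (simp only: scf_def triangle_Suc power_add mult_ac)
  finally show ?thesis .
qed

lemma sum_ecf: "m \<ge> 1 \<Longrightarrow> (\<Sum>k\<le>n. ecf m k) = iqf m n"
proof (induction n)
  case (Suc n)
  have "iqf m n + ecf m (Suc n) = iqf m (Suc n)"
    by (subst iqf_Suc[OF Suc.prems, symmetric]) (simp add: ecf_def algebra_simps)
  with Suc show ?case by simp
qed simp

lemma locfin_nat:
  fixes f :: "nat \<Rightarrow> 'a::zero fps"
  assumes "\<And>i n. n < i \<Longrightarrow> fps_nth (f i) n = 0"
  shows "locfin f I"
proof -
  have "finite {i\<in>I. i \<le> n}" for n by (rule finite_subset[of _ "{..n}"]) auto
  then show ?thesis by (rule locfinI) (rule assms)
qed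

lemma fsum_nat_nth:
  assumes "\<And>i. n < i \<Longrightarrow> fps_nth (f i) n = 0"
  shows "fps_nth (fsum f UNIV) n = (\<Sum>i\<le>n. fps_nth (f i) n)"
  by (rule fsum_nth) (use assms in auto)

lemma locfin_ecf: "m \<ge> 1 \<Longrightarrow> locfin (ecf m) I"
  by (rule locfin_nat) (rule ecf_nth_eq_0)

lemma locfin_scf: "locfin scf I"
  by (rule locfin_nat) (rule scf_nth_eq_0)

lemma fsum_ecf: "m \<ge> 1 \<Longrightarrow> fsum (ecf m) UNIV = inverse (qinf m)"
proof (rule fps_ext)
  fix n assume m: "m \<ge> 1"
  have "fps_nth (fsum (ecf m) UNIV) n = fps_nth (\<Sum>k\<le>n. ecf m k) n"
    unfolding fps_sum_nth by (rule fsum_nat_nth) (rule ecf_nth_eq_0[OF m])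
  then show "fps_nth (fsum (ecf m) UNIV) n = fps_nth (inverse (qinf m)) n"
    by (simp only: sum_ecf[OF m] iqf_nth_inf m order_refl)
qed

text \<open>This is \<open>1 / (zq;q) = (-zq;q) / (z\<^sup>2q\<^sup>2;q\<^sup>2)\<close>, read off at \<open>z\<^sup>a\<close>.\<close>

lemma ecf_1_conv:
  defines "y \<equiv> (\<lambda>i. if even i then ecf 2 (i div 2) else 0)"
  shows "ecf 1 a = (\<Sum>i\<le>a. y i * scf (a - i))"
proof -
  define p where "p a = (\<Sum>i\<le>a. y i * scf (a - i))" for a
  have y_simps: "y 0 = 1" "y (Suc 0) = 0" by (simp_all add: y_def)
  have y_rec: "(1 - fps_X ^ Suc (Suc i)) * y (Suc (Suc i)) = fps_X ^ 2 * y i" for i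
  proof (cases "even i")
    case True
    then obtain j where j: "i = 2 * j" by blast
    have "Suc (Suc i) = 2 * Suc j" by (simp add: j)
    then show ?thesis using ecf_Suc[of 2 j] by (simp only: y_def j) simp
  qed (simp add: y_def)
  have p_rec: "(1 - fps_X ^ Suc (Suc b)) * p (Suc (Suc b))
      = fps_X ^ 2 * p b + fps_X ^ Suc (Suc b) * p (Suc b)" for b
  proof -
    let ?a = "Suc (Suc b)"
    have "(1 - fps_X ^ ?a) * (y i * scf (?a - i)) =
       ((1 - fps_X ^ i) * y i) * scf (?a - i) + fps_X ^ i * y i * ((1 - fps_X ^ (?a - i)) * scf (?a - i))"
      if "i \<le> ?a" for i
    proof -
      have "fps_X ^ ?a = (fps_X ^ i * fps_X ^ (?a - i) :: real fps)"
        using that by (simp only: power_add[symmetric] le_add_diff_inverse)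
      then show ?thesis by (simp only: ring_distribs mult_ac mult_1_left mult_1_right) simp
    qed
    then have "(1 - fps_X ^ ?a) * p ?a = (\<Sum>i\<le>?a. ((1 - fps_X ^ i) * y i) * scf (?a - i))
        + (\<Sum>i\<le>?a. fps_X ^ i * y i * ((1 - fps_X ^ (?a - i)) * scf (?a - i)))"
      unfolding p_def sum_distrib_left sum.distrib[symmetric] by (intro sum.cong refl) simp
    also have "(\<Sum>i\<le>?a. ((1 - fps_X ^ i) * y i) * scf (?a - i)) = fps_X ^ 2 * p b"
      unfolding p_def sum_distrib_left
      by (subst sum.atMost_Suc_shift, subst sum.atMost_Suc_shift)
         (simp add: y_simps y_rec mult.assoc del: power_Suc)
    also have "(\<Sum>i\<le>?a. fps_X ^ i * y i * ((1 - fps_X ^ (?a - i)) * scf (?a - i)))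
        = (\<Sum>i\<le>Suc b. fps_X ^ ?a * (y i * scf (Suc b - i)))"
    proof -
      have "fps_X ^ i * y i * ((1 - fps_X ^ (?a - i)) * scf (?a - i)) = fps_X ^ ?a * (y i * scf (Suc b - i))"
        if "i \<le> Suc b" for i
      proof -
        have i: "?a - i = Suc (Suc b - i)" using that by simp
        have "fps_X ^ ?a = (fps_X ^ i * fps_X ^ (?a - i) :: real fps)"
          using that by (simp only: power_add[symmetric]) simp
        then show ?thesis unfolding i scf_Suc by (simp only: i mult_ac)
      qed
      then have "(\<Sum>i\<le>Suc b. fps_X ^ i * y i * ((1 - fps_X ^ (?a - i)) * scf (?a - i)))
          = (\<Sum>i\<le>Suc b. fps_X ^ ?a * (y i * scf (Suc b - i)))"
        by (intro sum.cong refl) simp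
      then show ?thesis by (subst sum.atMost_Suc) (simp del: power_Suc sum.atMost_Suc)
    qed
    finally show ?thesis unfolding p_def sum_distrib_left .
  qed
  have nz: "(1 - fps_X ^ Suc n :: real fps) \<noteq> 0" for n
    using one_minus_X_nth[of 1 0 n] by (metis fps_one_nth fps_zero_nth le0 mult_1 order_refl zero_neq_one)
  have e_rec: "(1 - fps_X ^ Suc b) * ecf 1 (Suc b) = fps_X * ecf 1 b" for b
    using ecf_Suc[of 1 b] by simp
  have "ecf 1 a = p a"
  proof (induction a rule: less_induct)
    case (less a)
    consider "a = 0" | "a = Suc 0" | b where "a = Suc (Suc b)" by (metis not0_implies_Suc)
    then show ?case
    proof cases
      case 1 then show ?thesis by (simp add: p_def y_simps)
    next
      case 2
      have "(1 - fps_X ^ Suc 0) * ecf 1 (Suc 0) = (1 - fps_X ^ Suc 0) * p (Suc 0)"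
        using e_rec[of 0] scf_Suc[of 0] by (simp add: p_def y_simps)
      then show ?thesis using nz 2 by (metis mult_left_cancel)
    next
      case (3 b)
      have IH: "p b = ecf 1 b" "p (Suc b) = ecf 1 (Suc b)" using less 3 by auto
      have "(1 - fps_X ^ Suc (Suc b)) * p (Suc (Suc b))
          = fps_X * (fps_X * ecf 1 b) + fps_X ^ Suc (Suc b) * ecf 1 (Suc b)"
        unfolding p_rec IH by (simp add: power2_eq_square mult.assoc)
      also have "\<dots> = fps_X * ecf 1 (Suc b)"
        by (simp only: e_rec[of b, symmetric]) (simp add: algebra_simps)
      also have "\<dots> = (1 - fps_X ^ Suc (Suc b)) * ecf 1 (Suc (Suc b))"
        by (rule e_rec[symmetric])
      finally show ?thesis using nz 3 by (metis mult_left_cancel)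
    qed
  qed
  then show ?thesis by (simp add: p_def)
qed

lemma ecf_1_fsum:
  "ecf 1 a = fsum (\<lambda>(j,r). ecf 2 j * scf r) {(j,r). 2 * j + r = a}"
proof -
  let ?y = "\<lambda>i. if even i then ecf 2 (i div 2) else 0"
  have "ecf 1 a = (\<Sum>i\<le>a. ?y i * scf (a - i))" by (rule ecf_1_conv)
  also have "\<dots> = (\<Sum>i\<in>{i. i \<le> a \<and> even i}. ecf 2 (i div 2) * scf (a - i))"
    by (rule sum.mono_neutral_cong_right) auto
  also have "\<dots> = (\<Sum>(j,r)\<in>{(j,r). 2 * j + r = a}. ecf 2 j * scf r)"
    by (rule sum.reindex_bij_witness[of _ "\<lambda>(j,r). 2 * j" "\<lambda>i. (i div 2, a - i)"]) auto
  also have "\<dots> = fsum (\<lambda>(j,r). ecf 2 j * scf r) {(j,r). 2 * j + r = a}"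
  proof (rule fsum_finite[symmetric])
    show "finite {(j,r). 2 * j + r = a}"
      by (rule finite_subset[of _ "{..a} \<times> {..a}"]) auto
  qed
  finally show ?thesis .
qed

lemma locfin_ecf_scf: "locfin (\<lambda>(j,r). ecf 2 j * scf r) I"
  by (rule locfin_subset[of _ "UNIV \<times> UNIV"])
     (rule locfin_prod, auto intro!: locfin_ecf locfin_scf)

lemma fibre_image: "(\<lambda>p. (g p, p)) ` UNIV = Sigma UNIV (\<lambda>a. {p. g p = a})"
  by auto

lemma fsum_fibres:
  assumes "locfin f UNIV"
  shows "fsum f UNIV = fsum (\<lambda>a. fsum f {p. g p = a}) UNIV"
    and "locfin (\<lambda>a. fsum f {p. g p = a}) UNIV"
proof -
  have inj: "inj_on (\<lambda>p. (g p, p)) UNIV" by (auto simp: inj_on_def)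
  have lf: "locfin (\<lambda>(a,p). f p) (Sigma UNIV (\<lambda>a. {p. g p = a}))"
    unfolding fibre_image[symmetric] locfin_reindex[OF inj] using assms by simp
  have "fsum f UNIV = fsum (\<lambda>(a,p). f p) (Sigma UNIV (\<lambda>a. {p. g p = a}))"
    unfolding fibre_image[symmetric] fsum_reindex[OF inj] by simp
  also have "\<dots> = fsum (\<lambda>a. fsum f {p. g p = a}) UNIV"
    by (rule fsum_Sigma[OF lf])
  finally show "fsum f UNIV = fsum (\<lambda>a. fsum f {p. g p = a}) UNIV" .
  show "locfin (\<lambda>a. fsum f {p. g p = a}) UNIV"
    by (rule locfin_Sigma_outer[OF lf])
qed

lemma fsum_scf: "fsum scf UNIV = pinf"
proof -
  have "inverse (qinf 1) = fsum (ecf 1) UNIV" by (simp add: fsum_ecf)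
  also have "ecf 1 = (\<lambda>a. fsum (\<lambda>(j,r). ecf 2 j * scf r) {p. (case p of (j,r) \<Rightarrow> 2 * j + r) = a})"
    by (rule ext, subst ecf_1_fsum, rule fsum_cong) auto
  also have "fsum \<dots> UNIV = fsum (\<lambda>(j,r). ecf 2 j * scf r) (UNIV \<times> UNIV)"
    unfolding UNIV_Times_UNIV by (rule fsum_fibres(1)[OF locfin_ecf_scf, symmetric])
  also have "\<dots> = inverse (qinf 2) * fsum scf UNIV"
    by (subst fsum_prod) (simp_all add: locfin_ecf locfin_scf fsum_ecf)
  finally have eq: "inverse (qinf 1) = inverse (qinf 2) * fsum scf UNIV" .
  have inv: "qinf 2 * inverse (qinf 2) = 1" "qinf 1 * inverse (qinf 1) = 1"
    by (rule inverse_mult_eq_1', simp)+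
  have "fsum scf UNIV = qinf 2 * inverse (qinf 2) * fsum scf UNIV"
    unfolding inv by simp
  also have "\<dots> = qinf 2 * inverse (qinf 1)"
    unfolding eq by (rule mult.assoc)
  also have "\<dots> = pinf"
    unfolding qinf_2 mult.assoc inv by simp
  finally show ?thesis .
qed

section \<open>Tail sums of the coefficients of a theta product\<close>

lemma locfin_const:
  fixes f :: "'i \<Rightarrow> 'a::comm_ring_1 fps"
  assumes "locfin f I"
  shows "locfin (\<lambda>i. fps_const (c i) * f i) I"
  unfolding locfin_def
proof
  fix n
  show "finite {i\<in>I. fps_nth (fps_const (c i) * f i) n \<noteq> 0}"
    by (rule finite_subset[OF _ locfinD[OF assms, of n]]) auto
qed

lemma locfin_X_mult:
  fixes f :: "nat \<Rightarrow> 'a::comm_ring_1 fps"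
  assumes "\<And>i. i \<in> I \<Longrightarrow> i \<le> h i"
  shows "locfin (\<lambda>i. fps_X ^ h i * f i) I"
proof (rule locfinI[of _ "\<lambda>i. i"])
  show "finite {i\<in>I. i \<le> n}" for n by (rule finite_subset[of _ "{..n}"]) auto
  show "fps_nth (fps_X ^ h i * f i) n = 0" if "i \<in> I" "n < i" for i n
    using assms[OF that(1)] that(2) by (simp add: fps_X_power_mult_nth)
qed

lemma triangle_add: "triangle (Suc t + m) + triangle t = triangle m + Suc t * (Suc t + m)"
proof (induction m)
  case 0
  show ?case by (induction t) auto
qed auto

lemma scf_add_Suc: "scf (Suc b) + scf b = fps_X ^ triangle b * iqf 1 (Suc b)"
proof -
  have "scf b = fps_X ^ triangle b * ((1 - fps_X ^ (1 * Suc b)) * iqf 1 (Suc b))"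
    unfolding iqf_Suc[OF order_refl] scf_def ..
  moreover have "scf (Suc b) = fps_X ^ triangle b * (fps_X ^ Suc b * iqf 1 (Suc b))"
    by (simp only: scf_def triangle_Suc power_add mult.assoc)
  ultimately show ?thesis by (simp add: algebra_simps)
qed

text \<open>\<open>Scf m\<close> is the coefficient of \<open>z\<^sup>m\<close> in \<open>(-zq;q)(-q/z;q)\<close>; \<open>dcf m\<close> enumerates all
  partitions by their Durfee rectangle of size \<open>b \<times> (b + m)\<close>.\<close>

definition Scf :: "nat \<Rightarrow> real fps" where
  "Scf m = fsum (\<lambda>t. scf (t + m) * scf t) UNIV"

definition dcf :: "nat \<Rightarrow> real fps" where
  "dcf m = fsum (\<lambda>b. fps_X ^ (b * (b + m)) * (iqf 1 b * iqf 1 (b + m))) UNIV"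

lemma locfin_Scf: "locfin (\<lambda>t. scf (t + m) * scf t) UNIV"
  using locfin_X_mult[of UNIV triangle "\<lambda>t. iqf 1 t * scf (t + m)"] triangle_ge
  by (simp add: scf_def mult_ac)

lemma locfin_dcf: "locfin (\<lambda>b. fps_X ^ (b * (b + m)) * (iqf 1 b * iqf 1 (b + m))) UNIV"
  by (rule locfin_X_mult) (metis le_0_eq le_add1 le_square le_trans mult_le_mono2)

lemma dcf_Suc: "dcf m = dcf (Suc m)"
proof -
  define T where "T c = fps_X ^ (Suc c * (Suc c + m)) * (iqf 1 c * iqf 1 (Suc c + m))" for c
  have lT: "locfin T UNIV" unfolding T_def
    by (rule locfin_X_mult) simp
  define D where "D m b = fps_X ^ (b * (b + m)) * (iqf 1 b * iqf 1 (b + m))" for m b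
  have lD: "locfin (D m) UNIV" for m unfolding D_def by (rule locfin_dcf)
  have D0: "D m 0 - D (Suc m) 0 = - T 0"
  proof -
    have "D m 0 = (1 - fps_X ^ (1 * Suc m)) * iqf 1 (Suc m)"
      unfolding iqf_Suc[OF order_refl] by (simp add: D_def)
    then show ?thesis by (simp add: D_def T_def algebra_simps)
  qed
  have DS: "D m (Suc c) - D (Suc m) (Suc c) = T c - T (Suc c)" for c
  proof -
    define E where "E = (fps_X ^ (Suc c * (Suc c + m)) :: real fps)"
    define u where "u = iqf 1 (Suc c)"
    define w where "w = iqf 1 (Suc (Suc c + m))"
    define A where "A = (fps_X ^ Suc c :: real fps)"
    define C where "C = (fps_X ^ Suc (Suc c + m) :: real fps)"
    have c: "iqf 1 c = (1 - A) * u"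
      using iqf_Suc[of 1 c] by (simp only: u_def A_def mult_1 order_refl)
    have cm: "iqf 1 (Suc c + m) = (1 - C) * w"
      using iqf_Suc[of 1 "Suc c + m"] by (simp only: w_def C_def mult_1 order_refl)
    have 1: "D m (Suc c) = E * (u * ((1 - C) * w))"
      unfolding D_def E_def[symmetric] cm u_def[symmetric] ..
    have 2: "D (Suc m) (Suc c) = E * A * (u * w)"
      unfolding D_def E_def A_def u_def w_def power_add[symmetric] by (simp add: algebra_simps)
    have 3: "T c = E * ((1 - A) * u * ((1 - C) * w))"
      unfolding T_def E_def[symmetric] cm c ..
    have 4: "T (Suc c) = E * A * C * (u * w)"
      unfolding T_def E_def A_def C_def u_def w_def power_add[symmetric] by (simp add: algebra_simps)
    show ?thesis unfolding 1 2 3 4 by (simp add: algebra_simps)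
  qed
  have "dcf m - dcf (Suc m) = fsum (\<lambda>b. D m b - D (Suc m) b) UNIV"
    unfolding dcf_def D_def[symmetric] by (rule fsum_diff[symmetric]) (rule lD)+
  also have "\<dots> = (D m 0 - D (Suc m) 0) + fsum (\<lambda>c. D m (Suc c) - D (Suc m) (Suc c)) UNIV"
    by (rule fsum_nat_split) (intro locfin_diff lD)
  also have "\<dots> = - T 0 + fsum (\<lambda>c. T c - T (Suc c)) UNIV"
    by (simp only: D0 DS)
  also have "fsum (\<lambda>c. T c - T (Suc c)) UNIV = fsum T UNIV - fsum (\<lambda>c. T (Suc c)) UNIV"
    using locfin_nat_shift[OF lT, of 1] by (intro fsum_diff lT) simp
  also have "fsum T UNIV = T 0 + fsum (\<lambda>c. T (Suc c)) UNIV"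
    by (rule fsum_nat_split[OF lT])
  finally show ?thesis by simp
qed

lemma dcf_eq: "dcf m = inverse (qinf 1)"
proof (rule fps_ext)
  fix n
  have const: "dcf k = dcf 0" for k by (induction k) (auto simp: dcf_Suc[symmetric])
  have "fps_nth (dcf n) n = (\<Sum>b\<in>{0}. fps_nth (fps_X ^ (b * (b + n)) * (iqf 1 b * iqf 1 (b + n))) n)"
    unfolding dcf_def
  proof (rule fsum_nth)
    fix b :: nat assume "b \<in> UNIV - {0}"
    then obtain c where "b = Suc c" by (metis DiffE insertI1 not0_implies_Suc)
    then have "n < b * (b + n)" by simp
    then show "fps_nth (fps_X ^ (b * (b + n)) * (iqf 1 b * iqf 1 (b + n))) n = 0"
      by (simp only: fps_X_power_mult_nth if_True)
  qed auto
  also have "\<dots> = fps_nth (iqf 1 n) n" by simp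
  also have "\<dots> = fps_nth (inverse (qinf 1)) n" by (rule iqf_nth_inf) auto
  finally show "fps_nth (dcf m) n = fps_nth (inverse (qinf 1)) n"
    using const[of m] const[of n] by simp
qed

lemma Scf_add_Suc: "Scf m + Scf (Suc m) = fps_X ^ triangle m * inverse (qinf 1)"
proof -
  have "Scf m = scf m + fsum (\<lambda>t. scf (Suc t + m) * scf (Suc t)) UNIV"
    unfolding Scf_def by (subst fsum_nat_split[OF locfin_Scf]) simp
  moreover have "Scf (Suc m) = fsum (\<lambda>t. scf (Suc t + m) * scf t) UNIV"
    by (simp add: Scf_def)
  ultimately have "Scf m + Scf (Suc m) = scf m
      + (fsum (\<lambda>t. scf (Suc t + m) * scf (Suc t)) UNIV + fsum (\<lambda>t. scf (Suc t + m) * scf t) UNIV)"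
    by simp
  also have "fsum (\<lambda>t. scf (Suc t + m) * scf (Suc t)) UNIV + fsum (\<lambda>t. scf (Suc t + m) * scf t) UNIV
      = fsum (\<lambda>t. scf (Suc t + m) * scf (Suc t) + scf (Suc t + m) * scf t) UNIV"
    using locfin_nat_shift[OF locfin_Scf[of m], of 1] locfin_Scf[of "Suc m"]
    by (intro fsum_add[symmetric]) simp_all
  also have "\<dots> = fsum (\<lambda>t. fps_X ^ triangle m
      * (fps_X ^ (Suc t * (Suc t + m)) * (iqf 1 (Suc t) * iqf 1 (Suc t + m)))) UNIV"
  proof (rule fsum_cong[OF refl])
    fix t
    have "scf (Suc t + m) * scf (Suc t) + scf (Suc t + m) * scf t
        = fps_X ^ (triangle (Suc t + m) + triangle t) * (iqf 1 (Suc t) * iqf 1 (Suc t + m))"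
      unfolding distrib_left[symmetric] scf_add_Suc power_add by (simp add: scf_def mult_ac)
    also have "\<dots> = fps_X ^ triangle m
      * (fps_X ^ (Suc t * (Suc t + m)) * (iqf 1 (Suc t) * iqf 1 (Suc t + m)))"
      unfolding triangle_add power_add by (rule mult.assoc)
    finally show "scf (Suc t + m) * scf (Suc t) + scf (Suc t + m) * scf t
       = fps_X ^ triangle m * (fps_X ^ (Suc t * (Suc t + m)) * (iqf 1 (Suc t) * iqf 1 (Suc t + m)))" .
  qed
  also have "scf m + \<dots> = fsum (\<lambda>b. fps_X ^ triangle m
      * (fps_X ^ (b * (b + m)) * (iqf 1 b * iqf 1 (b + m)))) UNIV"
    by (subst fsum_nat_split[OF locfin_mult_left[OF locfin_dcf[of m], of "fps_X ^ triangle m"]])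
       (simp add: scf_def)
  also have "\<dots> = fps_X ^ triangle m * dcf m"
    unfolding dcf_def by (rule fsum_mult_left[OF locfin_dcf])
  finally show ?thesis by (simp only: dcf_eq)
qed

text \<open>Truncated subtraction makes \<open>Zcf K\<close> the sum of \<open>max 0 (r - t - K)\<close> over the given weights.\<close>

definition Zcf :: "nat \<Rightarrow> real fps" where
  "Zcf K = fsum (\<lambda>(r,t). fps_const (real (r - t - K)) * (scf r * scf t)) UNIV"

lemma locfin_scf2: "locfin (\<lambda>(r,t). scf r * scf t) I"
  by (rule locfin_subset[of _ "UNIV \<times> UNIV"]) (rule locfin_prod, auto intro!: locfin_scf)

lemma locfin_Zcf: "locfin (\<lambda>(r,t). fps_const (c r t) * (scf r * scf t)) I"
  using locfin_const[OF locfin_scf2, of "\<lambda>(r,t). c r t" I] by (simp add: case_prod_unfold)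

lemma Zcf_eq: "Zcf K = fsum (\<lambda>i. fps_const (real (Suc i)) * Scf (K + Suc i)) UNIV"
proof -
  let ?f = "\<lambda>(r,t). fps_const (real (r - t - K)) * (scf r * scf t)"
  define h where "h = (\<lambda>(i,t). (t + (K + Suc i), t))"
  have inj: "inj_on h (UNIV \<times> UNIV)" by (auto simp: inj_on_def h_def)
  have "Zcf K = fsum ?f (h ` (UNIV \<times> UNIV))"
    unfolding Zcf_def
  proof (rule fsum_zero_outside)
    fix p assume p: "p \<in> UNIV - h ` (UNIV \<times> UNIV)"
    obtain r t where rt: "p = (r, t)" by fastforce
    have "r \<le> t + K"
    proof (rule ccontr)
      assume "\<not> r \<le> t + K"
      then have "h (r - t - K - 1, t) = p" by (simp add: h_def rt)
      with p show False by (metis DiffD2 UNIV_I UNIV_Times_UNIV image_eqI)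
    qed
    then show "?f p = 0" by (simp add: rt)
  qed simp
  also have "\<dots> = fsum (\<lambda>(i,t). fps_const (real (Suc i)) * (scf (t + (K + Suc i)) * scf t)) (UNIV \<times> UNIV)"
    unfolding fsum_reindex[OF inj] by (simp add: h_def case_prod_unfold)
  also have "\<dots> = fsum (\<lambda>i. fsum (\<lambda>t. fps_const (real (Suc i)) * (scf (t + (K + Suc i)) * scf t)) UNIV) UNIV"
  proof (rule fsum_Sigma)
    have "locfin ?f (h ` (UNIV \<times> UNIV))" by (rule locfin_Zcf)
    then show "locfin (\<lambda>(i,t). fps_const (real (Suc i)) * (scf (t + (K + Suc i)) * scf t)) (UNIV \<times> UNIV)"
      unfolding locfin_reindex[OF inj] by (simp add: h_def case_prod_unfold)
  qed
  also have "\<dots> = fsum (\<lambda>i. fps_const (real (Suc i)) * Scf (K + Suc i)) UNIV"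
    unfolding Scf_def by (simp only: fsum_mult_left[OF locfin_Scf])
  finally show ?thesis .
qed

lemma Scf_nth_eq_0: "n < m \<Longrightarrow> fps_nth (Scf m) n = 0"
  unfolding Scf_def
  by (subst fsum_nth[of "{}"]) (auto simp: scf_def mult.assoc fps_X_power_mult_nth intro: less_le_trans[OF _ triangle_ge])

lemma locfin_Scf_weighted: "locfin (\<lambda>i. fps_const (c i) * Scf (K + i)) UNIV"
  by (intro locfin_const locfin_nat Scf_nth_eq_0) simp

lemma locfin_X_triangle:
  fixes c :: "nat \<Rightarrow> real"
  shows "locfin (\<lambda>i. fps_const (c i) * fps_X ^ triangle (K + i)) UNIV"
proof (rule locfin_const, rule locfin_nat)
  show "fps_nth (fps_X ^ triangle (K + i) :: real fps) n = 0" if "n < i" for i n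
    using triangle_ge[of "K + i"] that by (simp add: fps_X_power_nth)
qed

lemma Zcf_add_Suc:
  "qinf 1 * (Zcf K + Zcf (Suc K)) = fsum (\<lambda>i. fps_const (real (Suc i)) * fps_X ^ triangle (K + Suc i)) UNIV"
proof -
  have "Zcf K + Zcf (Suc K)
      = fsum (\<lambda>i. fps_const (real (Suc i)) * Scf (K + Suc i) + fps_const (real (Suc i)) * Scf (Suc K + Suc i)) UNIV"
    unfolding Zcf_eq using locfin_Scf_weighted[of "\<lambda>i. real (Suc i)" "Suc K"]
      locfin_Scf_weighted[of "\<lambda>i. real (Suc i)" "Suc (Suc K)"]
    by (intro fsum_add[symmetric]) simp_all
  also have "\<dots> = fsum (\<lambda>i. (fps_const (real (Suc i)) * fps_X ^ triangle (K + Suc i)) * inverse (qinf 1)) UNIV"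
    by (intro fsum_cong refl) (simp only: distrib_left[symmetric] add_Suc Scf_add_Suc mult.assoc)
  also have "\<dots> = fsum (\<lambda>i. fps_const (real (Suc i)) * fps_X ^ triangle (K + Suc i)) UNIV * inverse (qinf 1)"
    using locfin_X_triangle[of "\<lambda>i. real (Suc i)" "Suc K"] by (intro fsum_mult_right) simp
  finally have "qinf 1 * (Zcf K + Zcf (Suc K))
      = fsum (\<lambda>i. fps_const (real (Suc i)) * fps_X ^ triangle (K + Suc i)) UNIV * (qinf 1 * inverse (qinf 1))"
    by (simp only: mult_ac)
  also have "qinf 1 * inverse (qinf 1) = 1" by (rule inverse_mult_eq_1') simp
  finally show ?thesis by simp
qed

lemma Zcf_diff:
  "qinf 1 * Zcf K - qinf 1 * Zcf (Suc (Suc K)) = fsum (\<lambda>i. fps_X ^ triangle (K + Suc i)) UNIV"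
proof -
  let ?W = "\<lambda>K i. fps_const (real (Suc i)) * fps_X ^ triangle (K + Suc i)"
  have lW: "locfin (?W K) UNIV" for K
    using locfin_X_triangle[of "\<lambda>i. real (Suc i)" "Suc K"] by simp
  let ?U = "\<lambda>i. fps_X ^ triangle (K + Suc i) :: real fps"
  have lU: "locfin ?U UNIV"
    using locfin_X_triangle[of "\<lambda>i. 1" "Suc K"] by simp
  have "qinf 1 * Zcf K - qinf 1 * Zcf (Suc (Suc K))
      = qinf 1 * (Zcf K + Zcf (Suc K)) - qinf 1 * (Zcf (Suc K) + Zcf (Suc (Suc K)))"
    by (simp add: algebra_simps)
  also have "\<dots> = fsum (?W K) UNIV - fsum (?W (Suc K)) UNIV"
    by (simp only: Zcf_add_Suc)
  also have "fsum (?W K) UNIV = ?W K 0 + fsum (\<lambda>i. ?W K (Suc i)) UNIV"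
    by (rule fsum_nat_split[OF lW])
  also have "?W K 0 + fsum (\<lambda>i. ?W K (Suc i)) UNIV - fsum (?W (Suc K)) UNIV
      = ?W K 0 + fsum (\<lambda>i. ?W K (Suc i) - ?W (Suc K) i) UNIV"
    by (subst fsum_diff[OF locfin_nat_shift[OF lW[of K], of 1, unfolded Suc_eq_plus1[symmetric]] lW])
       (rule add_diff_eq[symmetric])
  also have "(\<lambda>i. ?W K (Suc i) - ?W (Suc K) i) = (\<lambda>i. ?U (Suc i))"
  proof
    fix i
    have "fps_const (real (Suc (Suc i))) = fps_const (real (Suc i)) + 1"
      by (simp add: fps_eq_iff)
    then show "?W K (Suc i) - ?W (Suc K) i = ?U (Suc i)"
      by (simp only:) (simp add: algebra_simps)
  qed
  also have "?W K 0 + fsum (\<lambda>i. ?U (Suc i)) UNIV = fsum ?U UNIV"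
    by (subst fsum_nat_split[OF lU]) simp
  finally show ?thesis .
qed

lemma Zcf_nth_eq_0: "n < K \<Longrightarrow> fps_nth (Zcf K) n = 0"
  unfolding Zcf_eq by (subst fsum_nth[of "{}"]) (auto simp: Scf_nth_eq_0)

lemma qinf_Zcf_nonneg: "0 \<le> fps_nth (qinf 1 * Zcf K) n"
proof -
  have step: "fps_nth (qinf 1 * Zcf (Suc (Suc K))) n \<le> fps_nth (qinf 1 * Zcf K) n" for K
  proof -
    have "0 \<le> fps_nth (qinf 1 * Zcf K - qinf 1 * Zcf (Suc (Suc K))) n"
      unfolding Zcf_diff by (rule fsum_nonneg) (simp add: fps_X_power_nth)
    then show ?thesis by simp
  qed
  have "fps_nth (qinf 1 * Zcf (K + 2 * j)) n \<le> fps_nth (qinf 1 * Zcf K) n" for j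
  proof (induction j)
    case (Suc j)
    with step[of "K + 2 * j"] show ?case by simp
  qed simp
  from this[of "Suc n"] show ?thesis
    by (simp add: fps_mult_nth Zcf_nth_eq_0)
qed

lemma qinf_Zcf_0_nth_1: "1 \<le> fps_nth (qinf 1 * Zcf 0) 1"
proof -
  have "fps_nth (qinf 1 * Zcf 0 - qinf 1 * Zcf (Suc (Suc 0))) 1 = 1"
    unfolding Zcf_diff by (subst fsum_nth[of "{0}"]) (auto simp: fps_X_power_nth)
  then show ?thesis using qinf_Zcf_nonneg[of "Suc (Suc 0)" 1] by simp
qed

section \<open>The excess of the crank moment\<close>

definition wt :: "(nat \<times> nat) \<times> (nat \<times> nat) \<Rightarrow> real fps" where
  "wt = (\<lambda>((j,k),(r,t)). (ecf 2 j * ecf 2 k) * (scf r * scf t))"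

lemma locfin_ecf2: "m \<ge> 1 \<Longrightarrow> locfin (\<lambda>(a,b). ecf m a * ecf m b) I"
  by (rule locfin_subset[of _ "UNIV \<times> UNIV"]) (rule locfin_prod, auto intro!: locfin_ecf)

lemma locfin_wt: "locfin wt I"
proof (rule locfin_subset[of _ "UNIV \<times> UNIV"])
  have "locfin (\<lambda>(p,q). (case p of (j,k) \<Rightarrow> ecf 2 j * ecf 2 k) * (case q of (r,t) \<Rightarrow> scf r * scf t)) (UNIV \<times> UNIV)"
    by (intro locfin_prod locfin_ecf2 locfin_scf2) simp
  then show "locfin wt (UNIV \<times> UNIV)" by (simp add: wt_def case_prod_unfold)
qed simp

lemma crank_moment_quad:
  "fsum (\<lambda>(a,b). fps_const (c a b) * (ecf 1 a * ecf 1 b)) UNIV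
   = fsum (\<lambda>p. case p of ((j,k),(r,t)) \<Rightarrow> fps_const (c (2*j+r) (2*k+t)) * wt p) UNIV"
    (is "_ = fsum ?F UNIV")
proof -
  define g where "g = (\<lambda>((j,k),(r,t)). (2 * j + r :: nat, 2 * k + t :: nat))"
  define h where "h = (\<lambda>((j,r),(k,t)). ((j::nat,k::nat),(r::nat,t::nat)))"
  have lF: "locfin ?F I" for I
    using locfin_const[OF locfin_wt, of "\<lambda>((j,k),(r,t)). c (2*j+r) (2*k+t)" I]
    by (simp add: case_prod_unfold)
  define A where "A a = {(j,r). 2 * j + r = (a::nat)}" for a
  have fib: "fsum ?F {p. g p = (a, b)} = fps_const (c a b) * (ecf 1 a * ecf 1 b)" for a b
  proof -
    have inj: "inj_on h (A a \<times> A b)" by (auto simp: inj_on_def h_def)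
    have im: "{p. g p = (a, b)} = h ` (A a \<times> A b)"
    proof
      show "{p. g p = (a, b)} \<subseteq> h ` (A a \<times> A b)"
      proof
        fix p assume p: "p \<in> {p. g p = (a, b)}"
        obtain j k r t where jk: "p = ((j,k),(r,t))" by (metis surj_pair)
        then have "((j,r),(k,t)) \<in> A a \<times> A b" "h ((j,r),(k,t)) = p"
          using p by (auto simp: A_def g_def h_def)
        then show "p \<in> h ` (A a \<times> A b)" by (metis image_eqI)
      qed
    qed (auto simp: A_def g_def h_def)
    let ?ys = "\<lambda>(j,r). ecf 2 j * scf r"
    have "fsum ?F {p. g p = (a, b)} = fsum (\<lambda>p. ?F (h p)) (A a \<times> A b)"
      unfolding im by (rule fsum_reindex[OF inj])
    also have "\<dots> = fsum (\<lambda>q. fps_const (c a b) * (case q of (p,p') \<Rightarrow> ?ys p * ?ys p')) (A a \<times> A b)"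
      by (rule fsum_cong) (auto simp: A_def h_def wt_def mult_ac)
    also have "\<dots> = fps_const (c a b) * (fsum ?ys (A a) * fsum ?ys (A b))"
      by (subst fsum_mult_left, intro locfin_prod locfin_ecf_scf, subst fsum_prod)
         (auto intro: locfin_ecf_scf)
    finally show ?thesis unfolding A_def ecf_1_fsum .
  qed
  have "fsum ?F UNIV = fsum (\<lambda>q. fsum ?F {p. g p = q}) UNIV"
    by (rule fsum_fibres(1)[OF lF])
  also have "\<dots> = fsum (\<lambda>(a,b). fps_const (c a b) * (ecf 1 a * ecf 1 b)) UNIV"
    by (rule fsum_cong) (auto simp: fib)
  finally show ?thesis ..
qed

lemma fsum_wt_involution:
  assumes "\<And>p. s (s p) = p" "\<And>p. wt (s p) = wt p"
  shows "fsum (\<lambda>p. fps_const (c (s p)) * wt p) UNIV = fsum (\<lambda>p. fps_const (c p) * wt p) UNIV"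
proof -
  have inj: "inj_on s UNIV" using assms(1) by (metis injI)
  have "range s = UNIV" using assms(1) by (metis surjI)
  then have "fsum (\<lambda>p. fps_const (c p) * wt p) UNIV = fsum (\<lambda>p. fps_const (c p) * wt p) (range s)" by simp
  also have "\<dots> = fsum (\<lambda>p. fps_const (c (s p)) * wt p) UNIV"
    unfolding fsum_reindex[OF inj] assms(2) ..
  finally show ?thesis ..
qed

text \<open>The weight is invariant under exchanging \<open>j\<close> with \<open>k\<close> and, independently, \<open>r\<close> with \<open>t\<close>, so
  only the sum of a coefficient over this group of order four matters.\<close>

lemma fsum_wt_symmetrise:
  "4 * fsum (\<lambda>p. fps_const (c p) * wt p) UNIV = fsum (\<lambda>p. case p of ((j,k),(r,t)) \<Rightarrow>
     fps_const (c ((j,k),(r,t)) + c ((k,j),(r,t)) + c ((j,k),(t,r)) + c ((k,j),(t,r))) * wt p) UNIV"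
proof -
  define s1 where "s1 = (\<lambda>((j::nat,k::nat),(r::nat,t::nat)). ((k,j),(r,t)))"
  define s2 where "s2 = (\<lambda>((j::nat,k::nat),(r::nat,t::nat)). ((j,k),(t,r)))"
  define s3 where "s3 = (\<lambda>((j::nat,k::nat),(r::nat,t::nat)). ((k,j),(t,r)))"
  note l = locfin_const[OF locfin_wt]
  let ?T = "\<lambda>c. fsum (\<lambda>p. fps_const (c p) * wt p) UNIV"
  have s: "?T (\<lambda>p. c (s1 p)) = ?T c" "?T (\<lambda>p. c (s2 p)) = ?T c" "?T (\<lambda>p. c (s3 p)) = ?T c"
    by (rule fsum_wt_involution; auto simp: s1_def s2_def s3_def wt_def mult_ac)+
  have "4 * ?T c = ?T c + ?T (\<lambda>p. c (s1 p)) + ?T (\<lambda>p. c (s2 p)) + ?T (\<lambda>p. c (s3 p))"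
    unfolding s by simp
  also have "\<dots> = fsum (\<lambda>p. fps_const (c p) * wt p + fps_const (c (s1 p)) * wt p
      + fps_const (c (s2 p)) * wt p + fps_const (c (s3 p)) * wt p) UNIV"
    by (simp add: fsum_add locfin_add l)
  also have "\<dots> = fsum (\<lambda>p. case p of ((j,k),(r,t)) \<Rightarrow>
     fps_const (c ((j,k),(r,t)) + c ((k,j),(r,t)) + c ((j,k),(t,r)) + c ((k,j),(t,r))) * wt p) UNIV"
    by (rule fsum_cong)
       (auto simp: s1_def s2_def s3_def algebra_simps simp flip: fps_const_add)
  finally show ?thesis .
qed

text \<open>With \<open>D = 2j - 2k\<close> and \<open>S = r - t\<close> this is
  \<open>\<bar>D + S\<bar> + \<bar>D - S\<bar> = 2 * \<bar>D\<bar> + 2 * max 0 (\<bar>S\<bar> - \<bar>D\<bar>)\<close>.\<close>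

lemma positive_part_identity:
  fixes j k r t :: nat
  defines "K \<equiv> 2 * ((j - k) + (k - j))"
  shows "((2*j+r) - (2*k+t)) + ((2*k+r) - (2*j+t)) + ((2*j+t) - (2*k+r)) + ((2*k+t) - (2*j+r))
    = 2 * (2*j - 2*k) + 2 * (2*k - 2*j) + 2 * (r - t - K) + 2 * (t - r - K)"
proof -
  have *: "((2*j+r) - (2*(j+d)+(r+s))) + ((2*(j+d)+r) - (2*j+(r+s)))
      + ((2*j+(r+s)) - (2*(j+d)+r)) + ((2*(j+d)+(r+s)) - (2*j+r)) = 4 * d + 2 * (s - 2 * d)"
    for j r d s :: nat
  proof -
    have eqs: "(2*j+r) - (2*(j+d)+(r+s)) = 0" "(2*(j+d)+r) - (2*j+(r+s)) = 2*d - s"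
      "(2*j+(r+s)) - (2*(j+d)+r) = s - 2*d" "(2*(j+d)+(r+s)) - (2*j+r) = 2*d + s"
      by simp_all
    show ?thesis unfolding eqs by (cases "s \<le> 2 * d") auto
  qed
  show ?thesis
  proof (cases j k rule: le_cases; cases r t rule: le_cases)
    assume "j \<le> k" "r \<le> t"
    then obtain d s where "k = j + d" "t = r + s" by (metis le_Suc_ex)
    then show ?thesis using *[of j r d s] by (simp add: K_def)
  next
    assume "j \<le> k" "t \<le> r"
    then obtain d s where "k = j + d" "r = t + s" by (metis le_Suc_ex)
    then show ?thesis using *[of j t d s] by (simp add: K_def)
  next
    assume "k \<le> j" "r \<le> t"
    then obtain d s where "j = k + d" "t = r + s" by (metis le_Suc_ex)
    then show ?thesis using *[of k r d s] by (simp add: K_def)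
  next
    assume "k \<le> j" "t \<le> r"
    then obtain d s where "j = k + d" "r = t + s" by (metis le_Suc_ex)
    then show ?thesis using *[of k t d s] by (simp add: K_def)
  qed
qed

definition ymoment :: "real fps" where
  "ymoment = fsum (\<lambda>(j,k). fps_const (real (j - k)) * (ecf 2 j * ecf 2 k)) UNIV"

lemma locfin_ymoment: "locfin (\<lambda>(j,k). fps_const (c j k) * (ecf 2 j * ecf 2 k)) I"
  using locfin_const[OF locfin_ecf2[of 2], of "\<lambda>(j,k). c j k" I] by (simp add: case_prod_unfold)

lemma crank_moment_eq:
  "fsum (\<lambda>(a,b). fps_const (real (a - b)) * (ecf 1 a * ecf 1 b)) UNIV
   = 2 * pinf ^ 2 * ymoment + fsum (\<lambda>(j,k). ecf 2 j * ecf 2 k * Zcf (2 * ((j - k) + (k - j)))) UNIV"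
proof -
  let ?c = "\<lambda>((j,k),(r,t)). real ((2*j+r) - (2*k+t))"
  let ?d1 = "\<lambda>((j::nat,k),(r::nat,t::nat)). real (2*j - 2*k)"
  let ?d2 = "\<lambda>((j,k),(r,t)). real (r - t - 2 * ((j - k) + (k - j)))"
  let ?T = "\<lambda>c. fsum (\<lambda>p. fps_const (c p) * wt p) UNIV"
  note l = locfin_const[OF locfin_wt]
  have "fsum (\<lambda>(a,b). fps_const (real (a - b)) * (ecf 1 a * ecf 1 b)) UNIV = ?T ?c"
    unfolding crank_moment_quad by (rule fsum_cong) auto
  also have "?T ?c = ?T (\<lambda>p. ?d1 p + ?d2 p)"
  proof -
    have "4 * ?T ?c = 4 * ?T (\<lambda>p. ?d1 p + ?d2 p)"
      unfolding fsum_wt_symmetrise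
    proof (rule fsum_cong[OF refl])
      fix p :: "(nat \<times> nat) \<times> (nat \<times> nat)"
      obtain j k r t where p: "p = ((j,k),(r,t))" by (metis surj_pair)
      have eq: "real (2 * j + r - (2 * k + t)) + real (2 * k + r - (2 * j + t)) +
          real (2 * j + t - (2 * k + r)) + real (2 * k + t - (2 * j + r))
        = real (2*j - 2*k) + real (r - t - 2 * ((j - k) + (k - j)))
         + (real (2*k - 2*j) + real (r - t - 2 * ((k - j) + (j - k))))
         + (real (2*j - 2*k) + real (t - r - 2 * ((j - k) + (k - j))))
         + (real (2*k - 2*j) + real (t - r - 2 * ((k - j) + (j - k))))"
        using arg_cong[OF positive_part_identity[of j r k t], of real] by (simp add: add_ac)
      show "(case p of ((j,k),(r,t)) \<Rightarrow>
          fps_const (?c ((j,k),(r,t)) + ?c ((k,j),(r,t)) + ?c ((j,k),(t,r)) + ?c ((k,j),(t,r))) * wt p)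
        = (case p of ((j,k),(r,t)) \<Rightarrow> fps_const (
            (?d1 ((j,k),(r,t)) + ?d2 ((j,k),(r,t))) + (?d1 ((k,j),(r,t)) + ?d2 ((k,j),(r,t)))
            + (?d1 ((j,k),(t,r)) + ?d2 ((j,k),(t,r))) + (?d1 ((k,j),(t,r)) + ?d2 ((k,j),(t,r)))) * wt p)"
        unfolding p prod.case eq ..
    qed
    then show ?thesis by simp
  qed
  also have "\<dots> = ?T ?d1 + ?T ?d2"
    by (simp only: fps_const_add[symmetric] distrib_right fsum_add[OF l l])
  also have "?T ?d1 = fsum (\<lambda>(p,q). (2 * (case p of (j,k) \<Rightarrow> fps_const (real (j - k)) * (ecf 2 j * ecf 2 k)))
        * (case q of (r,t) \<Rightarrow> scf r * scf t)) (UNIV \<times> UNIV)"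
    unfolding UNIV_Times_UNIV
    by (rule fsum_cong) (auto simp: wt_def mult.assoc[symmetric] fps_numeral_fps_const simp flip: diff_mult_distrib2)
  also have "\<dots> = 2 * ymoment * (pinf * pinf)"
  proof -
    have "fsum (\<lambda>(r,t). scf r * scf t) UNIV = pinf * pinf"
      unfolding fsum_scf[symmetric] UNIV_Times_UNIV[symmetric]
      by (rule fsum_prod) (rule locfin_scf)+
    then show ?thesis
      by (subst fsum_prod) (auto intro: locfin_mult_left locfin_ymoment locfin_scf2
         simp: fsum_mult_left[OF locfin_ymoment] ymoment_def)
  qed
  also have "?T ?d2 = fsum (\<lambda>(j,k). ecf 2 j * ecf 2 k * Zcf (2 * ((j - k) + (k - j)))) UNIV"
  proof -
    let ?f = "\<lambda>p q. fps_const (?d2 (p,q)) * wt (p,q)"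
    have "?T ?d2 = fsum (\<lambda>(p,q). ?f p q) (UNIV \<times> UNIV)"
      unfolding UNIV_Times_UNIV by (rule fsum_cong) auto
    also have "\<dots> = fsum (\<lambda>p. fsum (?f p) UNIV) UNIV"
      by (rule fsum_Sigma) (use l[of ?d2 UNIV] in \<open>simp add: case_prod_unfold\<close>)
    also have "\<dots> = fsum (\<lambda>(j,k). ecf 2 j * ecf 2 k * Zcf (2 * ((j - k) + (k - j)))) UNIV"
    proof (rule fsum_cong[OF refl])
      fix p :: "nat \<times> nat"
      obtain j k where p: "p = (j, k)" by fastforce
      let ?K = "2 * ((j - k) + (k - j))"
      have "fsum (?f p) UNIV = fsum (\<lambda>q. ecf 2 j * ecf 2 k *
          (case q of (r,t) \<Rightarrow> fps_const (real (r - t - ?K)) * (scf r * scf t))) UNIV"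
        by (rule fsum_cong) (auto simp: p wt_def mult_ac)
      also have "\<dots> = ecf 2 j * ecf 2 k * Zcf ?K"
        unfolding Zcf_def by (rule fsum_mult_left[OF locfin_Zcf])
      finally show "fsum (?f p) UNIV = (case p of (j,k) \<Rightarrow> ecf 2 j * ecf 2 k * Zcf (2 * ((j - k) + (k - j))))"
        by (simp add: p)
    qed
    finally show ?thesis .
  qed
  finally show ?thesis by (simp add: power2_eq_square mult_ac)
qed

lemma fps_mult_nonneg:
  fixes f g :: "real fps"
  assumes "\<And>n. 0 \<le> fps_nth f n" "\<And>n. 0 \<le> fps_nth g n"
  shows "0 \<le> fps_nth (f * g) n"
  unfolding fps_mult_nth using assms by (auto intro!: sum_nonneg)

lemma ecf_2_nonneg: "0 \<le> fps_nth (ecf 2 j) n"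
proof -
  have "0 \<le> fps_nth (iqf 2 j) n" for n
  proof (induction j arbitrary: n)
    case (Suc j)
    show ?case
    proof (induction n rule: less_induct)
      case (less n)
      have "iqf 2 (Suc j) = iqf 2 j + fps_X ^ (2 * Suc j) * iqf 2 (Suc j)"
        by (subst iqf_Suc[symmetric]) (simp_all add: algebra_simps)
      from arg_cong[OF this, of "\<lambda>f. fps_nth f n"]
      have "fps_nth (iqf 2 (Suc j)) n = fps_nth (iqf 2 j) n
          + (if n < 2 * Suc j then 0 else fps_nth (iqf 2 (Suc j)) (n - 2 * Suc j))"
        by (simp only: fps_X_power_mult_nth fps_add_nth)
      then show ?case using Suc.IH[of n] less[of "n - 2 * Suc j"] by (auto split: if_splits)
    qed
  qed (auto simp: fps_one_nth)
  then show ?thesis by (simp add: ecf_def fps_X_power_mult_nth)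
qed

lemma pinf_partial:
  "0 \<le> fps_nth (\<Prod>k<M. 1 + fps_X ^ Suc k :: real fps) n"
  "n \<le> M \<Longrightarrow> 1 \<le> fps_nth (\<Prod>k<M. 1 + fps_X ^ Suc k :: real fps) n"
proof -
  show nn: "0 \<le> fps_nth (\<Prod>k<M. 1 + fps_X ^ Suc k :: real fps) n" for M n
    by (induction M arbitrary: n)
       (auto simp: fps_one_nth distrib_left fps_X_power_mult_right_nth simp del: power_Suc)
  show "1 \<le> fps_nth (\<Prod>k<M. 1 + fps_X ^ Suc k :: real fps) n" if "n \<le> M"
    using that
  proof (induction M)
    case (Suc M)
    let ?P = "\<Prod>k<M. 1 + fps_X ^ Suc k :: real fps"
    have e: "fps_nth (\<Prod>k<Suc M. 1 + fps_X ^ Suc k) n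
        = fps_nth ?P n + (if n < Suc M then 0 else fps_nth ?P (n - Suc M))"
      by (simp add: distrib_left fps_X_power_mult_right_nth del: power_Suc)
    show ?case
    proof (cases "n \<le> M")
      case True
      then show ?thesis using Suc.IH e nn[of M "n - Suc M"] by (auto split: if_splits)
    next
      case False
      with Suc.prems have n: "n = Suc M" by simp
      have "fps_nth ?P 0 = 1" by (induction M) (auto simp: fps_X_power_nth simp del: power_Suc)
      with e n nn[of M n] show ?thesis by simp
    qed
  qed simp
qed

lemma pinf_nth_ge_1: "1 \<le> fps_nth pinf n"
  using pinf_nth[of n n] pinf_partial(2)[of n n] by simp

lemma crank_excess_pos:
  assumes "n \<ge> 1"
  shows "0 < fps_nth (qinf 2 * fsum (\<lambda>(j,k). ecf 2 j * ecf 2 k * Zcf (2 * ((j - k) + (k - j)))) UNIV) n"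
proof -
  let ?f = "\<lambda>(j,k). ecf 2 j * ecf 2 k * Zcf (2 * ((j - k) + (k - j)))"
  have lf: "locfin ?f UNIV"
  proof (rule locfinI[of _ "\<lambda>(j,k). j + k"])
    show "finite {i \<in> UNIV. (case i :: nat \<times> nat of (j, k) \<Rightarrow> j + k) \<le> n}" for n
      by (rule finite_subset[of _ "{..n} \<times> {..n}"]) auto
    fix i :: "nat \<times> nat" and n assume i: "n < (case i of (j, k) \<Rightarrow> j + k)"
    obtain j k where jk: "i = (j, k)" by fastforce
    have "?f i = fps_X ^ (2 * j + 2 * k) * (iqf 2 j * iqf 2 k * Zcf (2 * ((j - k) + (k - j))))"
      by (simp add: jk ecf_def power_add mult_ac)
    then show "fps_nth (?f i) n = 0"
      using i by (simp only: jk fps_X_power_mult_nth) simp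
  qed
  let ?g = "\<lambda>(j,k). ecf 2 j * ecf 2 k * (qinf 1 * Zcf (2 * ((j - k) + (k - j))))"
  define G where "G = fsum ?g UNIV"
  have g_nonneg: "0 \<le> fps_nth (?g p) n" for p n
    by (cases p) (auto intro!: fps_mult_nonneg ecf_2_nonneg qinf_Zcf_nonneg simp del: One_nat_def)
  have eq: "qinf 1 * fsum ?f UNIV = G"
    unfolding G_def fsum_mult_left[OF lf, symmetric] by (rule fsum_cong) (auto simp: mult_ac)
  have G_nonneg: "0 \<le> fps_nth G n" for n
    unfolding G_def by (rule fsum_nonneg) (rule g_nonneg)
  have lg: "locfin ?g UNIV"
    using locfin_mult_left[OF lf, of "qinf 1"] by (simp add: case_prod_unfold mult_ac)
  have "1 \<le> fps_nth (?g (0,0)) 1" using qinf_Zcf_0_nth_1 by simp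
  also have "\<dots> \<le> fps_nth G 1"
  proof -
    have "fsum ?g UNIV = fsum ?g ({(0,0)} \<union> (UNIV - {(0,0)}))" by simp
    also have "\<dots> = fsum ?g {(0,0)} + fsum ?g (UNIV - {(0,0)})"
      by (rule fsum_Un_disjoint) (use lg in auto)
    also have "fsum ?g {(0,0)} = ?g (0,0)" by (simp add: fsum_finite)
    finally have "fps_nth G 1 = fps_nth (?g (0,0)) 1 + fps_nth (fsum ?g (UNIV - {(0,0)})) 1"
      unfolding G_def by simp
    moreover have "0 \<le> fps_nth (fsum ?g (UNIV - {(0,0)})) 1"
      by (rule fsum_nonneg) (rule g_nonneg)
    ultimately show ?thesis by simp
  qed
  finally have G1: "1 \<le> fps_nth G 1" .
  have "0 < fps_nth pinf (n - 1) * fps_nth G (n - (n - 1))"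
    using G1 pinf_nth_ge_1[of "n - 1"] assms by (intro mult_pos_pos) auto
  also have "\<dots> \<le> (\<Sum>i=0..n. fps_nth pinf i * fps_nth G (n - i))"
    by (rule member_le_sum) (use G_nonneg pinf_nth_ge_1 in \<open>auto intro!: mult_nonneg_nonneg intro: order_trans[of 0 1]\<close>)
  also have "\<dots> = fps_nth (pinf * G) n" by (simp add: fps_mult_nth)
  also have "pinf * G = qinf 2 * fsum ?f UNIV"
    unfolding qinf_2 eq[symmetric] by (rule mult.assoc[symmetric])
  finally show ?thesis .
qed

section \<open>The first residual crank\<close>

definition q_lift :: "real fps \<Rightarrow> zq_series" where
  "q_lift f = Abs_fps (\<lambda>n. fls_const (fps_nth f n))"

lemma q_lift_nth [simp]: "fps_nth (q_lift f) n = fls_const (fps_nth f n)"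
  by (simp add: q_lift_def)

lemma fls_const_sum: "fls_const (sum f A) = (\<Sum>x\<in>A. fls_const (f x :: real))"
  by (induction A rule: infinite_finite_induct) (simp_all add: fls_plus_const[symmetric])

lemma q_lift_mult: "q_lift (f * g) = q_lift f * q_lift g"
  by (simp add: fps_eq_iff fps_mult_nth fls_const_sum fls_const_mult_const)

lemma q_lift_1 [simp]: "q_lift 1 = 1"
  by (simp add: fps_eq_iff fps_one_nth)

lemma q_lift_X_power [simp]: "q_lift (fps_X ^ k) = fps_X ^ k"
  by (simp add: fps_eq_iff fps_X_power_nth)

lemma q_lift_add: "q_lift (f + g) = q_lift f + q_lift g"
  by (simp add: fps_eq_iff fls_plus_const)

lemma q_lift_diff: "q_lift (f - g) = q_lift f - q_lift g"
  by (simp add: fps_eq_iff fls_minus_const)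

lemma q_lift_prod: "q_lift (prod f A) = (\<Prod>x\<in>A. q_lift (f x))"
  by (induction A rule: infinite_finite_induct) (simp_all add: q_lift_mult)

lemma q_lift_prodinf:
  assumes "\<And>k i. i \<le> k \<Longrightarrow> fps_nth (f k) i = fps_nth 1 i"
  shows "q_lift (prodinf f) = prodinf (\<lambda>k. q_lift (f k))"
proof (rule fps_ext)
  fix n
  have l: "fps_nth (q_lift (f k)) i = fps_nth 1 i" if "i \<le> k" for k i
    using assms[OF that] by (simp add: fps_one_nth)
  show "fps_nth (q_lift (prodinf f)) n = fps_nth (prodinf (\<lambda>k. q_lift (f k))) n"
    using fps_prodinf_nth[of f n n, OF assms] fps_prodinf_nth[of "\<lambda>k. q_lift (f k)" n n, OF l]
    by (simp flip: q_lift_prod)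
qed

lemma qpoch_inf_q: "qpoch_inf q_var = q_lift (qinf 1)"
proof -
  have "q_lift (qinf 1) = prodinf (\<lambda>k. q_lift (1 - fps_X ^ (1 * Suc k)))"
    unfolding qinf_def by (rule q_lift_prodinf, rule one_minus_X_nth[OF order_refl])
  then show ?thesis
    unfolding qpoch_inf_def power_Suc[symmetric]
    by (simp only: q_lift_diff q_lift_1 q_lift_X_power mult_1)
qed

lemma qpoch_inf_minus_q: "qpoch_inf (- q_var) = q_lift pinf"
proof -
  have "q_lift pinf = prodinf (\<lambda>k. q_lift (1 + fps_X ^ Suc k))"
    unfolding pinf_def by (rule q_lift_prodinf, rule one_plus_X_nth)
  also have "\<dots> = prodinf (\<lambda>k. 1 + fps_X ^ Suc k)"
    by (simp only: q_lift_add q_lift_1 q_lift_X_power)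
  finally show ?thesis
    unfolding qpoch_inf_def by simp
qed

definition euler_series :: "real fls \<Rightarrow> nat \<Rightarrow> zq_series" where
  "euler_series u M = fsum (\<lambda>a. fps_const (u ^ a) * q_lift (fps_X ^ (a * M) * ecf 1 a)) UNIV"

lemma locfin_q_lift:
  assumes "\<And>a n. n < a \<Longrightarrow> fps_nth (g a) n = 0"
  shows "locfin (\<lambda>a. fps_const (c a) * q_lift (g a)) I"
  by (rule locfin_const, rule locfin_nat) (simp add: assms)

lemma X_ecf_nth_eq_0: "n < a \<Longrightarrow> fps_nth (fps_X ^ (a * M) * ecf 1 a) n = 0"
  by (simp add: fps_X_power_mult_nth ecf_nth_eq_0)

lemma euler_series_Suc:
  "(1 - fps_const u * fps_X ^ Suc M) * euler_series u M = euler_series u (Suc M)"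
proof -
  let ?t = "\<lambda>M a. fps_const (u ^ a) * q_lift (fps_X ^ (a * M) * ecf 1 a)"
  have l: "locfin (?t M) UNIV" for M by (rule locfin_q_lift[OF X_ecf_nth_eq_0])
  have step: "?t M (Suc a) - ?t (Suc M) (Suc a) = fps_const u * fps_X ^ Suc M * ?t M a" for a
  proof -
    have "fps_X ^ (Suc a * M) * ecf 1 (Suc a) - fps_X ^ (Suc a * Suc M) * ecf 1 (Suc a)
        = fps_X ^ (Suc a * M) * ((1 - fps_X ^ (1 * Suc a)) * ecf 1 (Suc a))"
      by (simp only: mult_Suc_right power_add) (simp add: algebra_simps)
    also have "\<dots> = fps_X ^ Suc M * (fps_X ^ (a * M) * ecf 1 a)"
      unfolding ecf_Suc[OF order_refl] by (simp add: power_add mult_ac)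
    finally have "q_lift (fps_X ^ (Suc a * M) * ecf 1 (Suc a)) - q_lift (fps_X ^ (Suc a * Suc M) * ecf 1 (Suc a))
        = fps_X ^ Suc M * q_lift (fps_X ^ (a * M) * ecf 1 a)"
      unfolding q_lift_diff[symmetric] by (simp only: q_lift_mult q_lift_X_power)
    then have "?t M (Suc a) - ?t (Suc M) (Suc a)
        = fps_const (u ^ Suc a) * (fps_X ^ Suc M * q_lift (fps_X ^ (a * M) * ecf 1 a))"
      by (simp only: right_diff_distrib[symmetric])
    also have "\<dots> = fps_const u * fps_X ^ Suc M * ?t M a"
    proof -
      have c: "fps_const (u ^ Suc a) = fps_const u * fps_const (u ^ a)" by simp
      show ?thesis unfolding c by (simp only: mult_ac)
    qed
    finally show ?thesis .
  qed
  have "euler_series u M - euler_series u (Suc M) = fsum (\<lambda>a. ?t M a - ?t (Suc M) a) UNIV"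
    unfolding euler_series_def by (rule fsum_diff[symmetric]) (rule l)+
  also have "\<dots> = (?t M 0 - ?t (Suc M) 0) + fsum (\<lambda>a. ?t M (Suc a) - ?t (Suc M) (Suc a)) UNIV"
    by (rule fsum_nat_split) (intro locfin_diff l)
  also have "\<dots> = fps_const u * fps_X ^ Suc M * euler_series u M"
    unfolding step euler_series_def by (subst fsum_mult_left[OF l]) simp
  finally show ?thesis by (simp add: algebra_simps)
qed

lemma qpoch_inf_nth:
  "n \<le> M \<Longrightarrow> fps_nth (qpoch_inf (fps_const u * q_var)) n
     = fps_nth (\<Prod>k<M. 1 - fps_const u * fps_X ^ Suc k) n"
  unfolding qpoch_inf_def
  by (subst fps_prodinf_nth[of _ n M]) (simp_all add: mult.assoc fps_X_power_nth flip: power_Suc)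

lemma euler_identity: "qpoch_inf (fps_const u * q_var) * euler_series u 0 = 1"
proof (rule fps_ext)
  fix n
  have prod: "(\<Prod>k<M. 1 - fps_const u * fps_X ^ Suc k) * euler_series u 0 = euler_series u M" for M
  proof (induction M)
    case (Suc M)
    then show ?case unfolding euler_series_Suc[symmetric] by (simp add: mult_ac)
  qed simp
  have "fps_nth (qpoch_inf (fps_const u * q_var) * euler_series u 0) n = fps_nth (euler_series u n) n"
    unfolding prod[of n, symmetric] by (rule fps_mult_nth_cong) (auto simp: qpoch_inf_nth)
  also have "\<dots> = (\<Sum>a\<in>{0}. fps_nth (fps_const (u ^ a) * q_lift (fps_X ^ (a * n) * ecf 1 a)) n)"
    unfolding euler_series_def
  proof (rule fsum_nth)
    fix a :: nat assume "a \<in> UNIV - {0}"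
    then have "a > 0" by simp
    then have "n < a * n + a" by (cases a) auto
    then have "n < a * n \<or> n - a * n < a" by linarith
    then have "fps_nth (fps_X ^ (a * n) * ecf 1 a) n = 0"
      unfolding fps_X_power_mult_nth using ecf_nth_eq_0[OF order_refl, of "n - a * n" a] by auto
    then show "fps_nth (fps_const (u ^ a) * q_lift (fps_X ^ (a * n) * ecf 1 a)) n = 0" by simp
  qed auto
  finally show "fps_nth (qpoch_inf (fps_const u * q_var) * euler_series u 0) n = fps_nth 1 n"
    by (simp add: fps_one_nth)
qed

lemma residual_crank_gf_eq:
  "residual_crank_gf = fsum (\<lambda>(a,b). fps_const (fls_X ^ a * fls_X_inv ^ b)
     * q_lift (qinf 2 * (ecf 1 a * ecf 1 b))) UNIV"
proof -
  let ?A = "qpoch_inf (z_var * q_var)" and ?B = "qpoch_inf (z_var_inv * q_var)"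
  let ?E = "euler_series fls_X 0" and ?F = "euler_series fls_X_inv 0"
  have l: "locfin (\<lambda>a. fps_const (u ^ a) * q_lift (ecf 1 a)) UNIV" for u
    by (rule locfin_q_lift) (rule ecf_nth_eq_0[OF order_refl])
  have es: "euler_series u 0 = fsum (\<lambda>a. fps_const (u ^ a) * q_lift (ecf 1 a)) UNIV" for u
    by (simp add: euler_series_def)
  have E: "?A * ?E = 1" "?B * ?F = 1" by (rule euler_identity)+
  then have nz: "?A * ?B \<noteq> 0" by (metis mult_eq_0_iff zero_neq_one)
  have "q_lift (qinf 1) = q_lift (qinf 1) * (?A * ?E) * (?B * ?F)" by (simp only: E mult_1_right)
  also have "\<dots> = q_lift (qinf 1) * (?E * ?F) * (?A * ?B)" by (simp only: mult_ac)
  finally have "crank_gf = q_lift (qinf 1) * (?E * ?F) * (?A * ?B) / (?A * ?B)"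
    unfolding crank_gf_def qpoch_inf_q by (rule arg_cong)
  also have "\<dots> = q_lift (qinf 1) * (?E * ?F)"
    using nz by (rule nonzero_mult_div_cancel_right)
  finally have "residual_crank_gf = q_lift (qinf 2) * (?E * ?F)"
    by (simp add: residual_crank_gf_def qpoch_inf_minus_q qinf_2 q_lift_mult mult.assoc)
  also have "?E * ?F = fsum (\<lambda>(a,b). (fps_const (fls_X ^ a) * q_lift (ecf 1 a))
      * (fps_const (fls_X_inv ^ b) * q_lift (ecf 1 b))) (UNIV \<times> UNIV)"
    unfolding es by (rule fsum_prod[symmetric]) (rule l)+
  also have "q_lift (qinf 2) * \<dots> = fsum (\<lambda>p. q_lift (qinf 2) * (case p of (a,b) \<Rightarrow>
      (fps_const (fls_X ^ a) * q_lift (ecf 1 a)) * (fps_const (fls_X_inv ^ b) * q_lift (ecf 1 b)))) (UNIV \<times> UNIV)"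
    by (rule fsum_mult_left[symmetric]) (intro locfin_prod l)
  also have "\<dots> = fsum (\<lambda>(a,b). fps_const (fls_X ^ a * fls_X_inv ^ b)
     * q_lift (qinf 2 * (ecf 1 a * ecf 1 b))) UNIV"
    unfolding UNIV_Times_UNIV
    by (rule fsum_cong) (auto simp: q_lift_mult mult_ac simp flip: fps_const_mult)
  finally show ?thesis .
qed

lemma ecf_prod_nth_eq_0:
  assumes "(a, b) \<notin> {..n} \<times> {..n}"
  shows "fps_nth (f * (ecf 1 a * ecf 1 b)) n = 0"
proof -
  have eq: "f * (ecf 1 a * ecf 1 b) = fps_X ^ (a + b) * (f * (iqf 1 a * iqf 1 b))"
    by (simp add: ecf_def power_add mult_ac)
  have "n < a + b" using assms by auto
  then show ?thesis unfolding eq by (simp only: fps_X_power_mult_nth if_True)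
qed

lemma Mbar_eq:
  "Mbar m n = (\<Sum>(a,b)\<in>{..n} \<times> {..n}. if m = int a - int b
     then fps_nth (qinf 2 * (ecf 1 a * ecf 1 b)) n else 0)"
proof -
  have mono: "fls_nth (fls_X ^ a * fls_X_inv ^ b :: real fls) m = (if m = int a - int b then 1 else 0)" for a b
    by (auto simp: fls_X_inv_power_times_conv_shift fls_X_power_nth)
  have "fps_nth residual_crank_gf n = (\<Sum>p\<in>{..n} \<times> {..n}. fps_nth (case p of (a,b) \<Rightarrow>
      fps_const (fls_X ^ a * fls_X_inv ^ b) * q_lift (qinf 2 * (ecf 1 a * ecf 1 b))) n)"
    unfolding residual_crank_gf_eq
  proof (rule fsum_nth)
    fix p :: "nat \<times> nat" assume "p \<in> UNIV - {..n} \<times> {..n}"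
    then obtain a b where p: "p = (a, b)" "(a, b) \<notin> {..n} \<times> {..n}" by (cases p) auto
    show "fps_nth (case p of (a,b) \<Rightarrow>
        fps_const (fls_X ^ a * fls_X_inv ^ b) * q_lift (qinf 2 * (ecf 1 a * ecf 1 b))) n = 0"
      using ecf_prod_nth_eq_0[OF p(2)] by (simp add: p(1))
  qed auto
  then show ?thesis
    unfolding Mbar_def fls_nth_sum
    by (auto simp: fls_nth_sum mono fls_mult_const_nth intro!: sum.cong)
qed

lemma Mbar1_plus_eq:
  "Mbar1_plus n = fps_nth (qinf 2 * fsum (\<lambda>(a,b). fps_const (real (a - b)) * (ecf 1 a * ecf 1 b)) UNIV) n"
proof -
  let ?x = "\<lambda>a b. fps_nth (qinf 2 * (ecf 1 a * ecf 1 b)) n"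
  have "Mbar1_plus n = (\<Sum>\<^sub>\<infinity>m\<in>{1..int n}. of_int m * Mbar m n)"
    unfolding Mbar1_plus_def
  proof (rule infsum_cong_neutral)
    fix m assume "m \<in> {1..} - {1..int n}"
    then have "m > int n" by auto
    then have "Mbar m n = 0" unfolding Mbar_eq by (intro sum.neutral) auto
    then show "of_int m * Mbar m n = 0" by simp
  qed auto
  also have "\<dots> = (\<Sum>m\<in>{1..int n}. of_int m * Mbar m n)" by simp
  also have "\<dots> = (\<Sum>(a,b)\<in>{..n} \<times> {..n}. \<Sum>m\<in>{1..int n}. if m = int a - int b then of_int m * ?x a b else 0)"
    unfolding Mbar_eq sum_distrib_left
    by (subst sum.swap) (simp add: case_prod_unfold if_distrib cong: if_cong)
  also have "\<dots> = (\<Sum>(a,b)\<in>{..n} \<times> {..n}. real (a - b) * ?x a b)"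
  proof (intro sum.cong refl, clarify)
    fix a b assume "a \<le> n" "b \<le> n"
    then show "(\<Sum>m\<in>{1..int n}. if m = int a - int b then of_int m * ?x a b else 0) = real (a - b) * ?x a b"
      by (auto simp: of_nat_diff)
  qed
  also have "\<dots> = fps_nth (fsum (\<lambda>p. qinf 2 * (case p of (a,b) \<Rightarrow> fps_const (real (a - b)) * (ecf 1 a * ecf 1 b))) UNIV) n"
  proof -
    have eq: "qinf 2 * (fps_const c * (ecf 1 a * ecf 1 b)) = fps_const c * (qinf 2 * (ecf 1 a * ecf 1 b))" for c a b
      by (rule mult.left_commute)
    have "fps_nth (qinf 2 * (case p of (a,b) \<Rightarrow> fps_const (real (a - b)) * (ecf 1 a * ecf 1 b))) n
        = (case p of (a,b) \<Rightarrow> real (a - b) * ?x a b)" for p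
      by (cases p) (simp only: prod.case eq fps_mult_left_const_nth)
    note nth = this
    show ?thesis
    proof (subst fsum_nth[of "{..n} \<times> {..n}"])
      fix p :: "nat \<times> nat" assume "p \<in> UNIV - {..n} \<times> {..n}"
      then obtain a b where p: "p = (a, b)" "(a, b) \<notin> {..n} \<times> {..n}" by (cases p) auto
      show "fps_nth (qinf 2 * (case p of (a,b) \<Rightarrow> fps_const (real (a - b)) * (ecf 1 a * ecf 1 b))) n = 0"
        unfolding nth using ecf_prod_nth_eq_0[OF p(2)] by (simp add: p(1))
    qed (simp_all only: nth, auto)
  qed
  also have "\<dots> = fps_nth (qinf 2 * fsum (\<lambda>(a,b). fps_const (real (a - b)) * (ecf 1 a * ecf 1 b)) UNIV) n"
    using locfin_const[OF locfin_ecf2[of 1], of "\<lambda>(a,b). real (a - b)" UNIV]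
    by (subst fsum_mult_left) (simp_all add: case_prod_unfold)
  finally show ?thesis .
qed

section \<open>Overpartitions by rank\<close>

definition ops :: "nat \<Rightarrow> nat \<Rightarrow> nat \<Rightarrow> (nat \<times> bool) list set" where
  "ops L p n = {ps. overpartition_of n ps \<and> (\<forall>x\<in>set ps. fst x \<le> L) \<and> length ps \<le> p}"

definition ops_plain :: "nat \<Rightarrow> nat \<Rightarrow> nat \<Rightarrow> (nat \<times> bool) list set" where
  "ops_plain L p n = {ps\<in>ops L p n. (L, True) \<notin> set ps}"

lemma overpartition_of_Nil [simp]: "overpartition_of n [] \<longleftrightarrow> n = 0"
  by (auto simp: overpartition_of_def)

lemma overpartition_of_Cons:
  "overpartition_of n ((a, b) # qs) \<longleftrightarrow> a > 0 \<and> a \<le> n \<and> overpartition_of (n - a) qs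
     \<and> (\<forall>x\<in>set qs. fst x \<le> a) \<and> (a, True) \<notin> set qs"
proof -
  have "(\<forall>i<length ((a, b) # qs). snd (((a, b) # qs) ! i) \<longrightarrow>
        (\<forall>j<i. fst (((a, b) # qs) ! j) \<noteq> fst (((a, b) # qs) ! i)))
      \<longleftrightarrow> (\<forall>i<length qs. snd (qs ! i) \<longrightarrow> a \<noteq> fst (qs ! i) \<and> (\<forall>j<i. fst (qs ! j) \<noteq> fst (qs ! i)))"
    by (simp add: All_less_Suc2)
  also have "\<dots> \<longleftrightarrow> (a, True) \<notin> set qs \<and>
      (\<forall>i<length qs. snd (qs ! i) \<longrightarrow> (\<forall>j<i. fst (qs ! j) \<noteq> fst (qs ! i)))"
  proof -
    have "(a, True) \<in> set qs \<longleftrightarrow> (\<exists>i<length qs. snd (qs ! i) \<and> fst (qs ! i) = a)"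
      by (auto simp: in_set_conv_nth prod_eq_iff)
    then show ?thesis by auto
  qed
  finally show ?thesis
    unfolding overpartition_of_def by auto
qed

lemma overpartition_of_bounds:
  assumes "overpartition_of n ps"
  shows "length ps \<le> n" "x \<in> set ps \<Longrightarrow> fst x \<le> n"
proof -
  have "overpartition_of n ps \<Longrightarrow> length ps \<le> n \<and> (\<forall>x\<in>set ps. fst x \<le> n)"
  proof (induction ps arbitrary: n)
    case (Cons q qs)
    obtain a b where q: "q = (a, b)" by fastforce
    with Cons.prems have *: "a > 0" "a \<le> n" "overpartition_of (n - a) qs" "\<forall>x\<in>set qs. fst x \<le> a"
      by (auto simp: overpartition_of_Cons)
    with Cons.IH[of "n - a"] show ?case by (auto simp: q)
  qed auto
  with assms show "length ps \<le> n" "x \<in> set ps \<Longrightarrow> fst x \<le> n" by auto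
qed

lemma finite_overpartitions: "finite {ps. overpartition_of n ps}"
proof (rule finite_subset)
  show "{ps. overpartition_of n ps} \<subseteq> {ps. set ps \<subseteq> {..n} \<times> UNIV \<and> length ps \<le> n}"
    using overpartition_of_bounds by fastforce
  show "finite {ps :: (nat \<times> bool) list. set ps \<subseteq> {..n} \<times> UNIV \<and> length ps \<le> n}"
    by (rule finite_lists_length_le) simp
qed

lemma finite_ops [simp]: "finite (ops L p n)" "finite (ops_plain L p n)"
  by (rule finite_subset[OF _ finite_overpartitions[of n]]; auto simp: ops_def ops_plain_def)+

lemma ops_0_right: "ops L 0 n = (if n = 0 then {[]} else {})" 
  by (auto simp: ops_def)

lemma ops_0_left: "ops 0 p n = (if n = 0 then {[]} else {})"
proof -
  have "ps = []" if "ps \<in> ops 0 p n" for ps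
    using that by (cases ps) (auto simp: ops_def overpartition_of_Cons)
  moreover have "[] \<in> ops 0 p n \<longleftrightarrow> n = 0" by (simp add: ops_def)
  ultimately show ?thesis by auto
qed

lemma ops_Suc:
  "ops (Suc L) (Suc p) n = ops_plain (Suc L) (Suc p) n \<union>
     (if Suc L \<le> n then Cons (Suc L, True) ` ops_plain (Suc L) p (n - Suc L) else {})"
proof -
  have "ps \<in> (if Suc L \<le> n then Cons (Suc L, True) ` ops_plain (Suc L) p (n - Suc L) else {})"
    if "ps \<in> ops (Suc L) (Suc p) n" "(Suc L, True) \<in> set ps" for ps
    using that by (cases ps) (force simp: ops_def ops_plain_def overpartition_of_Cons)+
  then have "ops (Suc L) (Suc p) n \<subseteq> ops_plain (Suc L) (Suc p) n \<union>
     (if Suc L \<le> n then Cons (Suc L, True) ` ops_plain (Suc L) p (n - Suc L) else {})"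
    unfolding ops_plain_def[of _ "Suc p"] by blast
  then show ?thesis
    by (rule equalityI) (auto simp: ops_def ops_plain_def overpartition_of_Cons split: if_splits)
qed

lemma ops_plain_Suc:
  "ops_plain (Suc L) (Suc p) n = ops L (Suc p) n \<union>
     (if Suc L \<le> n then Cons (Suc L, False) ` ops_plain (Suc L) p (n - Suc L) else {})"
proof -
  have "ps \<in> (if Suc L \<le> n then Cons (Suc L, False) ` ops_plain (Suc L) p (n - Suc L) else {})"
    if ps: "ps \<in> ops_plain (Suc L) (Suc p) n" "ps \<notin> ops L (Suc p) n" for ps
  proof (cases ps)
    case Nil
    then show ?thesis using ps by (auto simp: ops_def ops_plain_def)
  next
    case (Cons q qs)
    obtain a b where q: "q = (a, b)" by fastforce
    from ps(1) have *: "overpartition_of n ((a,b) # qs)" "a \<le> Suc L" "(a,b) \<noteq> (Suc L, True)"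
       "(Suc L, True) \<notin> set qs" "length qs \<le> p"
      by (auto simp: ops_def ops_plain_def Cons q)
    have "a = Suc L"
    proof (rule ccontr)
      assume "a \<noteq> Suc L"
      with * have "ps \<in> ops L (Suc p) n" by (fastforce simp: ops_def Cons q overpartition_of_Cons)
      with ps(2) show False ..
    qed
    with * show ?thesis by (auto simp: ops_def ops_plain_def Cons q overpartition_of_Cons)
  qed
  then have "ops_plain (Suc L) (Suc p) n \<subseteq> ops L (Suc p) n \<union>
     (if Suc L \<le> n then Cons (Suc L, False) ` ops_plain (Suc L) p (n - Suc L) else {})"
    by blast
  moreover have "ops L (Suc p) n \<subseteq> ops_plain (Suc L) (Suc p) n"
    by (force simp: ops_def ops_plain_def)
  moreover have "Cons (Suc L, False) ` ops_plain (Suc L) p (n - Suc L) \<subseteq> ops_plain (Suc L) (Suc p) n"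
    if "Suc L \<le> n"
    using that by (auto simp: ops_def ops_plain_def overpartition_of_Cons)
  ultimately show ?thesis by (intro equalityI Un_least) auto
qed

definition opgf :: "nat \<Rightarrow> nat \<Rightarrow> real fps" where
  "opgf L p = Abs_fps (\<lambda>n. real (card (ops L p n)))"

definition opgf_plain :: "nat \<Rightarrow> nat \<Rightarrow> real fps" where
  "opgf_plain L p = Abs_fps (\<lambda>n. real (card (ops_plain L p n)))"

lemma opgf_0 [simp]: "opgf L 0 = 1" "opgf 0 p = 1"
  by (auto simp: opgf_def fps_eq_iff fps_one_nth ops_0_right ops_0_left)

lemma opgf_plain_0_right: "opgf_plain L 0 = 1"
proof -
  have "ops_plain L 0 n = ops L 0 n" for n by (auto simp: ops_plain_def ops_def)
  then show ?thesis by (auto simp: opgf_plain_def fps_eq_iff fps_one_nth ops_0_right)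
qed

lemma opgf_Suc_plain: "opgf (Suc L) (Suc p) = opgf_plain (Suc L) (Suc p) + fps_X ^ Suc L * opgf_plain (Suc L) p"
proof (rule fps_ext)
  fix n
  have "card (ops (Suc L) (Suc p) n) = card (ops_plain (Suc L) (Suc p) n) +
     card (if Suc L \<le> n then Cons (Suc L, True) ` ops_plain (Suc L) p (n - Suc L) else {})"
    unfolding ops_Suc by (rule card_Un_disjoint) (simp, simp, auto simp: ops_plain_def[of _ "Suc p"])
  then show "fps_nth (opgf (Suc L) (Suc p)) n
      = fps_nth (opgf_plain (Suc L) (Suc p) + fps_X ^ Suc L * opgf_plain (Suc L) p) n"
    by (simp add: opgf_def opgf_plain_def fps_X_power_mult_nth card_image del: power_Suc)
qed

lemma opgf_plain_Suc: "opgf_plain (Suc L) (Suc p) = opgf L (Suc p) + fps_X ^ Suc L * opgf_plain (Suc L) p"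
proof (rule fps_ext)
  fix n
  have "card (ops_plain (Suc L) (Suc p) n) = card (ops L (Suc p) n) +
     card (if Suc L \<le> n then Cons (Suc L, False) ` ops_plain (Suc L) p (n - Suc L) else {})"
    unfolding ops_plain_Suc by (rule card_Un_disjoint) (simp, simp, auto simp: ops_def[of L])
  then show "fps_nth (opgf_plain (Suc L) (Suc p)) n
      = fps_nth (opgf L (Suc p) + fps_X ^ Suc L * opgf_plain (Suc L) p) n"
    by (simp add: opgf_def opgf_plain_def fps_X_power_mult_nth card_image del: power_Suc)
qed

lemma two_opgf_plain: "2 * opgf_plain (Suc L) p = opgf (Suc L) p + opgf L p"
  by (cases p) (simp_all add: opgf_plain_0_right opgf_Suc_plain opgf_plain_Suc del: power_Suc)

lemma opgf_Suc:
  "opgf (Suc L) (Suc p) = opgf L (Suc p) + fps_X ^ Suc L * (opgf (Suc L) p + opgf L p)"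
  unfolding two_opgf_plain[symmetric] opgf_Suc_plain opgf_plain_Suc by (simp del: power_Suc)

lemma opgf_step_algebra:
  fixes w x y a b c d f g X l m :: "'a::comm_ring_1"
  assumes "w = x + X * l * (y + a)" "x = b + l * (a + c)" "y = a + X * l * (d + f)" "a = c + l * (f + g)"
    and "x = a + X * m * (b + c)" "y = d + m * (a + f)" "a = f + m * (c + g)"
  shows "w = y + X * m * (x + a)"
proof -
  have "w - (y + X * m * (x + a)) = (x - y) + X * l * (y + a) - X * m * (x + a)"
    using assms(1) by (simp add: algebra_simps)
  also have "x - y = X * m * (b + c) - X * l * (d + f)"
    using assms(3,5) by (metis add_diff_cancel_left)
  also have "X * m * (b + c) - X * l * (d + f) + X * l * (y + a) - X * m * (x + a)
     = X * l * ((y - d) + (a - f)) - X * m * ((x - b) + (a - c))"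
    by (simp add: algebra_simps)
  also have "y - d = m * (a + f)" using assms(6) by simp
  also have "a - f = m * (c + g)" using assms(7) by simp
  also have "x - b = l * (a + c)" using assms(2) by simp
  also have "a - c = l * (f + g)" using assms(4) by simp
  finally have "w - (y + X * m * (x + a)) = 0" by (simp add: algebra_simps)
  then show ?thesis by simp
qed

text \<open>This is \<open>opgf_Suc\<close> with the two arguments exchanged; in effect \<open>opgf\<close> is symmetric.\<close>

lemma opgf_Suc':
  "opgf (Suc L) (Suc p) = opgf (Suc L) p + fps_X ^ Suc p * (opgf L (Suc p) + opgf L p)"
proof (induction L arbitrary: p)
  case 0
  show ?case
  proof (induction p)
    case 0
    show ?case by (simp add: opgf_Suc)
  next
    case (Suc p)
    have "opgf (Suc 0) (Suc (Suc p)) = 1 + fps_X * (opgf (Suc 0) (Suc p) + 1)"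
      by (subst opgf_Suc) simp
    also have "\<dots> = 1 + fps_X * (opgf (Suc 0) p + fps_X ^ Suc p * 2 + 1)"
      by (subst Suc) simp
    also have "\<dots> = (1 + fps_X * (opgf (Suc 0) p + 1)) + fps_X ^ Suc (Suc p) * 2"
      by (simp add: algebra_simps)
    also have "1 + fps_X * (opgf (Suc 0) p + 1) = opgf (Suc 0) (Suc p)"
      by (subst opgf_Suc) simp
    finally show ?case by simp
  qed
next
  case (Suc l)
  note IHL = Suc
  show ?case
  proof (induction p)
    case 0
    have "opgf (Suc (Suc l)) (Suc 0) = opgf (Suc l) (Suc 0) + fps_X ^ Suc (Suc l) * 2"
      by (subst opgf_Suc) simp
    also have "opgf (Suc l) (Suc 0) = 1 + fps_X * (opgf l (Suc 0) + 1)"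
      using IHL[of 0] by simp
    also have "\<dots> + fps_X ^ Suc (Suc l) * 2 = 1 + fps_X * ((opgf l (Suc 0) + fps_X ^ Suc l * 2) + 1)"
      by (simp add: algebra_simps)
    also have "opgf l (Suc 0) + fps_X ^ Suc l * 2 = opgf (Suc l) (Suc 0)"
      by (subst opgf_Suc) simp
    finally show ?case by simp
  next
    case (Suc m)
    have "opgf (Suc (Suc l)) (Suc (Suc m)) = opgf (Suc (Suc l)) (Suc m)
        + fps_X * fps_X ^ Suc m * (opgf (Suc l) (Suc (Suc m)) + opgf (Suc l) (Suc m))"
    proof (rule opgf_step_algebra)
      show "opgf (Suc (Suc l)) (Suc (Suc m)) = opgf (Suc l) (Suc (Suc m))
          + fps_X * fps_X ^ Suc l * (opgf (Suc (Suc l)) (Suc m) + opgf (Suc l) (Suc m))"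
        unfolding power_Suc[symmetric] by (rule opgf_Suc)
      show "opgf (Suc l) (Suc (Suc m)) = opgf l (Suc (Suc m)) + fps_X ^ Suc l * (opgf (Suc l) (Suc m) + opgf l (Suc m))"
        by (rule opgf_Suc)
      show "opgf (Suc (Suc l)) (Suc m) = opgf (Suc l) (Suc m) + fps_X * fps_X ^ Suc l * (opgf (Suc (Suc l)) m + opgf (Suc l) m)"
        unfolding power_Suc[symmetric] by (rule opgf_Suc)
      show "opgf (Suc l) (Suc m) = opgf l (Suc m) + fps_X ^ Suc l * (opgf (Suc l) m + opgf l m)"
        by (rule opgf_Suc)
      show "opgf (Suc l) (Suc (Suc m)) = opgf (Suc l) (Suc m) + fps_X * fps_X ^ Suc m * (opgf l (Suc (Suc m)) + opgf l (Suc m))"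
        unfolding power_Suc[symmetric] by (rule IHL)
      show "opgf (Suc (Suc l)) (Suc m) = opgf (Suc (Suc l)) m + fps_X ^ Suc m * (opgf (Suc l) (Suc m) + opgf (Suc l) m)"
        by (rule Suc)
      show "opgf (Suc l) (Suc m) = opgf (Suc l) m + fps_X ^ Suc m * (opgf l (Suc m) + opgf l m)"
        by (rule IHL)
    qed
    then show ?case by (simp only: power_Suc)
  qed
qed

definition all_gf :: "real fps" where
  "all_gf = Abs_fps (\<lambda>n. real (card {ps. overpartition_of n ps}))"

lemma ops_stable: "n \<le> p \<Longrightarrow> n \<le> p' \<Longrightarrow> ops L p n = ops L p' n"
  unfolding ops_def using overpartition_of_bounds(1) by fastforce

lemma all_gf_eq: "all_gf * qinf 1 = pinf"
proof (rule fps_ext)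
  fix n
  define B where "B L = Abs_fps (\<lambda>n. real (card (ops L n n)))" for L
  have B: "fps_nth (opgf L p) i = fps_nth (B L) i" if "i \<le> p" for L p i
    using ops_stable[of i p i L] that by (simp add: B_def opgf_def)
  have B_Suc: "B (Suc L) = B L + fps_X ^ Suc L * (B (Suc L) + B L)" for L
  proof (rule fps_ext)
    fix n
    have "fps_nth (B (Suc L)) n = fps_nth (opgf (Suc L) (Suc n)) n" by (simp add: B)
    also have "\<dots> = fps_nth (opgf L (Suc n)) n + fps_nth (fps_X ^ Suc L * (opgf (Suc L) n + opgf L n)) n"
      by (subst opgf_Suc) (simp only: fps_add_nth)
    also have "fps_nth (fps_X ^ Suc L * (opgf (Suc L) n + opgf L n)) n = fps_nth (fps_X ^ Suc L * (B (Suc L) + B L)) n"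
      by (rule fps_mult_nth_cong) (auto simp: B)
    finally show "fps_nth (B (Suc L)) n = fps_nth (B L + fps_X ^ Suc L * (B (Suc L) + B L)) n"
      by (simp add: B)
  qed
  have prod: "B L * qfac 1 L = (\<Prod>k<L. 1 + fps_X ^ Suc k)" for L
  proof (induction L)
    case 0
    have "B 0 = 1" by (auto simp: B_def fps_eq_iff fps_one_nth ops_0_left)
    then show ?case by simp
  next
    case (Suc L)
    have "B (Suc L) * (1 - fps_X ^ Suc L) = B L * (1 + fps_X ^ Suc L)"
      using B_Suc[of L] by (simp add: algebra_simps)
    then have "B (Suc L) * qfac 1 (Suc L) = (B L * qfac 1 L) * (1 + fps_X ^ Suc L)"
      by (simp add: qfac_def mult_ac del: power_Suc)
    then show ?case unfolding Suc by simp
  qed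
  have "fps_nth (all_gf * qinf 1) n = fps_nth (B n * qfac 1 n) n"
  proof (rule fps_mult_nth_cong)
    fix i assume i: "i \<le> n"
    have "{ps. overpartition_of i ps} = ops n i i"
      unfolding ops_def using overpartition_of_bounds i by fastforce
    then show "fps_nth all_gf i = fps_nth (B n) i" by (simp add: all_gf_def B_def)
    show "fps_nth (qinf 1) i = fps_nth (qfac 1 n) i" using i by (simp add: qinf_nth)
  qed
  then show "fps_nth (all_gf * qinf 1) n = fps_nth pinf n"
    by (simp only: prod pinf_nth[OF order_refl])
qed

definition rank_ge :: "nat \<Rightarrow> real fps" where
  "rank_ge k = Abs_fps (\<lambda>n. real (card {ps. overpartition_of n ps \<and> overpartition_rank ps \<ge> int k}))"

definition rank_le :: "nat \<Rightarrow> real fps" where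
  "rank_le r = Abs_fps (\<lambda>n. real (card {ps. overpartition_of n ps \<and> overpartition_rank ps \<le> int r}))"

lemma rank_le_add_rank_ge: "rank_le r + rank_ge (Suc r) = all_gf"
proof (rule fps_ext)
  fix n
  have "{ps. overpartition_of n ps} = {ps. overpartition_of n ps \<and> overpartition_rank ps \<le> int r}
      \<union> {ps. overpartition_of n ps \<and> overpartition_rank ps \<ge> int (Suc r)}" by auto
  then have "card {ps. overpartition_of n ps} = card ({ps. overpartition_of n ps \<and> overpartition_rank ps \<le> int r}
      \<union> {ps. overpartition_of n ps \<and> overpartition_rank ps \<ge> int (Suc r)})" by (rule arg_cong)
  also have "\<dots> = card {ps. overpartition_of n ps \<and> overpartition_rank ps \<le> int r}
      + card {ps. overpartition_of n ps \<and> overpartition_rank ps \<ge> int (Suc r)}"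
    by (rule card_Un_disjoint) (auto intro: finite_subset[OF _ finite_overpartitions[of n]])
  finally show "fps_nth (rank_le r + rank_ge (Suc r)) n = fps_nth all_gf n"
    by (simp add: rank_le_def rank_ge_def all_gf_def)
qed

lemma overpartition_rank_Cons:
  assumes "overpartition_of n ((a, b) # qs)"
  shows "overpartition_rank ((a, b) # qs) = int a - int (Suc (length qs))"
proof -
  have "Max (fst ` set ((a, b) # qs)) = a"
    by (rule Max_eqI) (use assms in \<open>auto simp: overpartition_of_Cons\<close>)
  then show ?thesis by (simp add: overpartition_rank_def)
qed

text \<open>Sorting the overpartitions of rank at least \<open>k\<close> by their largest part \<open>k + 1 + i\<close>.\<close>

lemma rank_ge_eq:
  assumes "k \<ge> 1"
  shows "rank_ge k = fsum (\<lambda>i. fps_X ^ (Suc k + i) * (opgf (Suc k + i) i + opgf (k + i) i)) UNIV"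
proof (rule fps_ext)
  fix n
  define H where "H i = (if Suc k + i \<le> n then (\<Union>b. Cons (Suc k + i, b) ` ops_plain (Suc k + i) i (n - (Suc k + i))) else {})" for i
  have eq: "{ps. overpartition_of n ps \<and> overpartition_rank ps \<ge> int k} = (\<Union>i\<in>{..n}. H i)"
  proof (intro equalityI subsetI)
    fix ps assume "ps \<in> {ps. overpartition_of n ps \<and> overpartition_rank ps \<ge> int k}"
    then have ps: "overpartition_of n ps" "overpartition_rank ps \<ge> int k" by auto
    from ps(2) assms have "ps \<noteq> []" by (auto simp: overpartition_rank_def)
    then obtain a b qs where q: "ps = (a, b) # qs" by (metis list.exhaust surj_pair)
    with ps have rk: "int a - int (Suc (length qs)) \<ge> int k" using overpartition_rank_Cons by simp
    define i where "i = a - Suc k"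
    have i: "a = Suc k + i" "length qs \<le> i" using rk by (auto simp: i_def)
    from ps(1) have *: "a \<le> n" "overpartition_of (n - a) qs" "\<forall>x\<in>set qs. fst x \<le> a" "(a, True) \<notin> set qs"
      unfolding q by (auto simp: overpartition_of_Cons)
    have "ps \<in> H i" using * i(2) unfolding q i(1) by (auto simp: H_def ops_plain_def ops_def)
    moreover have "i \<le> n" using *(1) i(1) by simp
    ultimately show "ps \<in> (\<Union>i\<in>{..n}. H i)" by blast
  next
    fix ps assume "ps \<in> (\<Union>i\<in>{..n}. H i)"
    then obtain i b qs where i: "Suc k + i \<le> n" "ps = (Suc k + i, b) # qs" "qs \<in> ops_plain (Suc k + i) i (n - (Suc k + i))"
      by (auto simp: H_def split: if_splits)
    then have "overpartition_of n ps" by (auto simp: ops_plain_def ops_def overpartition_of_Cons)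
    moreover from this have "overpartition_rank ps = int (Suc k + i) - int (Suc (length qs))"
      unfolding i(2) by (rule overpartition_rank_Cons)
    moreover have "length qs \<le> i" using i(3) by (simp add: ops_plain_def ops_def)
    ultimately show "ps \<in> {ps. overpartition_of n ps \<and> overpartition_rank ps \<ge> int k}" by simp
  qed
  have H_card: "real (card (H i)) = fps_nth (fps_X ^ (Suc k + i) * (opgf (Suc k + i) i + opgf (k + i) i)) n" for i
  proof -
    have "card (\<Union>b. Cons (Suc k + i, b) ` ops_plain (Suc k + i) i m) = 2 * card (ops_plain (Suc k + i) i m)" for m
      by (subst card_UN_disjoint) (auto simp: card_image UNIV_bool)
    then have "real (card (H i)) = fps_nth (fps_X ^ (Suc k + i) * (2 * opgf_plain (Suc (k + i)) i)) n"
      by (simp add: H_def fps_X_power_mult_nth opgf_plain_def fps_numeral_fps_const del: power_Suc)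
    then show ?thesis unfolding two_opgf_plain by simp
  qed
  have "fps_nth (rank_ge k) n = (\<Sum>i\<le>n. real (card (H i)))"
    unfolding rank_ge_def eq fps_nth_Abs_fps of_nat_sum[symmetric]
    by (rule arg_cong[where f = real], rule card_UN_disjoint) (auto simp: H_def)
  also have "\<dots> = fps_nth (fsum (\<lambda>i. fps_X ^ (Suc k + i) * (opgf (Suc k + i) i + opgf (k + i) i)) UNIV) n"
    unfolding H_card by (rule fsum_nat_nth[symmetric]) (simp add: fps_X_power_mult_nth del: power_Suc power_add)
  finally show "fps_nth (rank_ge k) n = fps_nth (fsum (\<lambda>i. fps_X ^ (Suc k + i) * (opgf (Suc k + i) i + opgf (k + i) i)) UNIV) n" .
qed

text \<open>Sorting the overpartitions of rank at most \<open>r\<close> by their number of parts \<open>p\<close>.\<close>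

lemma rank_le_eq:
  "rank_le r = 1 + fsum (\<lambda>p. fps_X ^ Suc p * (opgf (p + r) (Suc p) + opgf (p + r) p)) UNIV"
proof (rule fps_ext)
  fix n
  define H where "H p = ops (Suc p + r) (Suc p) n - ops (Suc p + r) p n" for p
  have rank_iff: "overpartition_rank ps \<le> int r \<longleftrightarrow> (\<forall>x\<in>set ps. fst x \<le> length ps + r)" if "overpartition_of n ps" for ps
  proof (cases ps)
    case (Cons q qs)
    obtain a b where q: "q = (a, b)" by fastforce
    have "overpartition_rank ps = int a - int (Suc (length qs))"
      using overpartition_rank_Cons that unfolding Cons q by blast
    moreover have "\<forall>x\<in>set qs. fst x \<le> a"
      using that unfolding Cons q by (simp add: overpartition_of_Cons)
    ultimately show ?thesis by (fastforce simp: Cons q)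
  qed (simp add: overpartition_rank_def)
  have eq: "{ps. overpartition_of n ps \<and> overpartition_rank ps \<le> int r} = (if n = 0 then {[]} else {}) \<union> (\<Union>p\<in>{..n}. H p)"
    (is "?A = ?B")
  proof (intro equalityI subsetI)
    fix ps assume "ps \<in> ?A"
    then have ps: "overpartition_of n ps" "\<forall>x\<in>set ps. fst x \<le> length ps + r" using rank_iff by auto
    show "ps \<in> ?B"
    proof (cases "length ps")
      case 0
      then show ?thesis using ps by auto
    next
      case (Suc p)
      then have "ps \<in> H p" using ps by (auto simp: H_def ops_def)
      moreover have "p \<le> n" using overpartition_of_bounds(1)[OF ps(1)] Suc by simp
      ultimately show ?thesis by auto
    qed
  next
    fix ps assume "ps \<in> ?B"
    then consider "n = 0" "ps = []" | p where "ps \<in> H p" by (auto split: if_splits)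
    then show "ps \<in> ?A"
    proof cases
      case 1
      then show ?thesis by (simp add: overpartition_rank_def)
    next
      case (2 p)
      then have "overpartition_of n ps" "length ps = Suc p" "\<forall>x\<in>set ps. fst x \<le> length ps + r"
        by (auto simp: H_def ops_def)
      with rank_iff show ?thesis by auto
    qed
  qed
  have H_card: "real (card (H p)) = fps_nth (fps_X ^ Suc p * (opgf (p + r) (Suc p) + opgf (p + r) p)) n" for p
  proof -
    have "ops (Suc p + r) p n \<subseteq> ops (Suc p + r) (Suc p) n" by (auto simp: ops_def)
    then have "real (card (H p)) = fps_nth (opgf (Suc (p + r)) (Suc p) - opgf (Suc (p + r)) p) n"
      by (simp add: H_def card_Diff_subset opgf_def of_nat_diff card_mono)
    then show ?thesis by (simp add: opgf_Suc' del: power_Suc)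
  qed
  have H_len: "length ps = Suc p" if "ps \<in> H p" for ps p
    using that by (auto simp: H_def ops_def)
  have H_fin: "finite (H p)" for p by (simp add: H_def)
  have "card {ps. overpartition_of n ps \<and> overpartition_rank ps \<le> int r}
     = card (if n = 0 then {[] :: (nat \<times> bool) list} else {}) + card (\<Union>p\<in>{..n}. H p)"
    unfolding eq by (rule card_Un_disjoint) (use H_fin in \<open>auto dest: H_len split: if_splits\<close>)
  also have "card (\<Union>p\<in>{..n}. H p) = (\<Sum>p\<le>n. card (H p))"
  proof (rule card_UN_disjoint)
    show "\<forall>i\<in>{..n}. \<forall>j\<in>{..n}. i \<noteq> j \<longrightarrow> H i \<inter> H j = {}"
      using H_len by (metis disjoint_iff nat.inject)
  qed (use H_fin in auto)
  finally have "fps_nth (rank_le r) n = fps_nth 1 n + (\<Sum>p\<le>n. real (card (H p)))"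
    by (simp add: rank_le_def fps_one_nth)
  also have "(\<Sum>p\<le>n. real (card (H p))) = fps_nth (fsum (\<lambda>p. fps_X ^ Suc p * (opgf (p + r) (Suc p) + opgf (p + r) p)) UNIV) n"
    unfolding H_card by (rule fsum_nat_nth[symmetric]) (simp add: fps_X_power_mult_nth del: power_Suc)
  finally show "fps_nth (rank_le r) n = fps_nth (1 + fsum (\<lambda>p. fps_X ^ Suc p * (opgf (p + r) (Suc p) + opgf (p + r) p)) UNIV) n"
    by simp
qed

lemma rank_ge_recurrence:
  assumes "k \<ge> 1"
  shows "rank_ge k + rank_ge (Suc k)
    = fps_X ^ Suc k * (2 * all_gf - (rank_ge (Suc (Suc k)) + rank_ge (Suc (Suc (Suc k)))))"
proof -
  let ?a = "\<lambda>i. fps_X ^ i * (opgf (Suc k + i) i + opgf (k + i) i)"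
  let ?b = "\<lambda>i. fps_X ^ Suc i * (opgf (Suc (Suc k) + i) i + opgf (Suc k + i) i)"
  let ?c = "\<lambda>p. fps_X ^ Suc p * (opgf (p + Suc k) (Suc p) + opgf (p + Suc k) p)"
  let ?d = "\<lambda>p. fps_X ^ Suc p * (opgf (p + Suc (Suc k)) (Suc p) + opgf (p + Suc (Suc k)) p)"
  have l: "locfin ?a UNIV" "locfin ?b UNIV" "locfin ?c UNIV" "locfin ?d UNIV" "locfin (\<lambda>i. ?a (Suc i)) UNIV"
    by (rule locfin_X_mult, simp)+
  have "rank_ge k = fsum (\<lambda>i. fps_X ^ Suc k * ?a i) UNIV"
    unfolding rank_ge_eq[OF assms] by (simp only: power_add mult.assoc)
  also have "\<dots> = fps_X ^ Suc k * fsum ?a UNIV"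
    by (rule fsum_mult_left[OF l(1)])
  also have "fsum ?a UNIV = 2 + fsum (\<lambda>i. ?a (Suc i)) UNIV"
    by (subst fsum_nat_split[OF l(1)]) simp
  finally have g1: "rank_ge k = fps_X ^ Suc k * (2 + fsum (\<lambda>i. ?a (Suc i)) UNIV)" .
  have pow: "fps_X ^ (Suc (Suc k) + i) = (fps_X ^ Suc k * fps_X ^ Suc i :: real fps)" for i
    by (simp only: power_add[symmetric] add_Suc add_Suc_right)
  have "rank_ge (Suc k) = fsum (\<lambda>i. fps_X ^ Suc k * ?b i) UNIV"
    by (subst rank_ge_eq, simp, intro fsum_cong refl, simp only: pow mult.assoc)
  also have "\<dots> = fps_X ^ Suc k * fsum ?b UNIV"
    by (rule fsum_mult_left[OF l(2)])
  finally have g2: "rank_ge (Suc k) = fps_X ^ Suc k * fsum ?b UNIV" .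
  have "fsum (\<lambda>i. ?a (Suc i)) UNIV + fsum ?b UNIV = fsum (\<lambda>i. ?a (Suc i) + ?b i) UNIV"
    by (rule fsum_add[OF l(5,2), symmetric])
  also have "\<dots> = fsum (\<lambda>i. ?c i + ?d i) UNIV"
    by (rule fsum_cong[OF refl]) (simp add: algebra_simps)
  also have "\<dots> = fsum ?c UNIV + fsum ?d UNIV"
    by (rule fsum_add[OF l(3,4)])
  finally have "2 + fsum (\<lambda>i. ?a (Suc i)) UNIV + fsum ?b UNIV = rank_le (Suc k) + rank_le (Suc (Suc k))"
    unfolding rank_le_eq by (simp add: add_ac)
  also have "\<dots> = 2 * all_gf - (rank_ge (Suc (Suc k)) + rank_ge (Suc (Suc (Suc k))))"
    using rank_le_add_rank_ge[of "Suc k"] rank_le_add_rank_ge[of "Suc (Suc k)"]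
    by (simp add: algebra_simps)
  finally show ?thesis
    unfolding g1 g2 distrib_left[symmetric] by (simp only:)
qed

section \<open>The positive rank moment\<close>

definition Ycf :: "nat \<Rightarrow> real fps" where
  "Ycf i = fsum (\<lambda>(j,k). ecf 2 j * ecf 2 k) {(j,k). k + i \<le> j}"

text \<open>Both \<open>Ycf i\<close> and \<open>fps_X ^ (2 * i)\<close> times the sum over the complement of the index set of
  \<open>Ycf (Suc i)\<close> equal the sum of \<open>ecf 2 (k + i) * iqf 2 k\<close> over \<open>k\<close>.\<close>

lemma Ycf_recurrence:
  "Ycf i + fps_X ^ (2 * i) * Ycf (Suc i) = fps_X ^ (2 * i) * (inverse (qinf 2)) ^ 2"
proof -
  let ?f = "\<lambda>(j,k). ecf 2 j * ecf 2 k"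
  have l: "locfin ?f I" for I by (rule locfin_ecf2) simp
  have T: "fsum ?f UNIV = (inverse (qinf 2)) ^ 2"
    using fsum_prod[OF locfin_ecf[of 2 UNIV] locfin_ecf[of 2 UNIV]]
    by (simp add: fsum_ecf power2_eq_square)
  define h where "h = (\<lambda>(m,k). (m + i, k :: nat))"
  have inj: "inj_on h A" for A by (auto simp: inj_on_def h_def)
  have im: "{(j,k). k + i \<le> j} = h ` Sigma UNIV (\<lambda>m. {..m})"
  proof
    show "{(j,k). k + i \<le> j} \<subseteq> h ` Sigma UNIV (\<lambda>m. {..m})"
    proof clarify
      fix j k assume "k + i \<le> j"
      then have "(j - i, k) \<in> Sigma UNIV (\<lambda>m. {..m})" "h (j - i, k) = (j, k)" by (auto simp: h_def)
      then show "(j, k) \<in> h ` Sigma UNIV (\<lambda>m. {..m})" by (metis image_eqI)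
    qed
  qed (auto simp: h_def)
  have "Ycf i = fsum (\<lambda>(m,k). ecf 2 (m + i) * ecf 2 k) (Sigma UNIV (\<lambda>m. {..m}))"
    unfolding Ycf_def im fsum_reindex[OF inj] by (simp add: h_def case_prod_unfold)
  also have "\<dots> = fsum (\<lambda>m. fsum (\<lambda>k. ecf 2 (m + i) * ecf 2 k) {..m}) UNIV"
  proof (rule fsum_Sigma)
    have "locfin ?f (h ` Sigma UNIV (\<lambda>m. {..m}))" by (rule l)
    then show "locfin (\<lambda>(m,k). ecf 2 (m + i) * ecf 2 k) (Sigma UNIV (\<lambda>m. {..m}))"
      unfolding locfin_reindex[OF inj] by (simp add: h_def case_prod_unfold)
  qed
  also have "\<dots> = fsum (\<lambda>m. ecf 2 (m + i) * iqf 2 m) UNIV"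
    by (simp add: fsum_finite sum_distrib_left[symmetric] sum_ecf)
  finally have Y: "Ycf i = fsum (\<lambda>m. ecf 2 (m + i) * iqf 2 m) UNIV" .
  have im': "{(j,k). j \<le> k + i} = prod.swap ` Sigma UNIV (\<lambda>k. {..k + i})"
    by (auto simp: image_iff)
  have inj': "inj_on prod.swap A" for A :: "(nat \<times> nat) set" by (auto simp: inj_on_def)
  have "fsum ?f {(j,k). j \<le> k + i} = fsum (\<lambda>(k,j). ecf 2 j * ecf 2 k) (Sigma UNIV (\<lambda>k. {..k + i}))"
    unfolding im' fsum_reindex[OF inj'] by (simp add: case_prod_unfold)
  also have "\<dots> = fsum (\<lambda>k. fsum (\<lambda>j. ecf 2 j * ecf 2 k) {..k + i}) UNIV"
  proof (rule fsum_Sigma)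
    have "locfin ?f (prod.swap ` Sigma UNIV (\<lambda>k. {..k + i}))" by (rule l)
    then show "locfin (\<lambda>(k,j). ecf 2 j * ecf 2 k) (Sigma UNIV (\<lambda>k. {..k + i}))"
      unfolding locfin_reindex[OF inj'] by (simp add: case_prod_unfold)
  qed
  also have "\<dots> = fsum (\<lambda>k. iqf 2 (k + i) * ecf 2 k) UNIV"
    by (simp add: fsum_finite sum_distrib_right[symmetric] sum_ecf)
  finally have D: "fsum ?f {(j,k). j \<le> k + i} = fsum (\<lambda>k. iqf 2 (k + i) * ecf 2 k) UNIV" .
  have "locfin (\<lambda>k. iqf 2 (k + i) * ecf 2 k) UNIV"
    by (rule locfin_nat, simp add: ecf_def mult.left_commute fps_X_power_mult_nth)
  then have "fps_X ^ (2 * i) * fsum ?f {(j,k). j \<le> k + i}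
      = fsum (\<lambda>k. fps_X ^ (2 * i) * (iqf 2 (k + i) * ecf 2 k)) UNIV"
    unfolding D by (rule fsum_mult_left[symmetric])
  also have "\<dots> = Ycf i"
    unfolding Y by (rule fsum_cong[OF refl]) (simp add: ecf_def add_mult_distrib2 power_add mult_ac)
  finally have "Ycf i = fps_X ^ (2 * i) * fsum ?f {(j,k). j \<le> k + i}" ..
  moreover have "fsum ?f {(j,k). j \<le> k + i} + Ycf (Suc i) = (inverse (qinf 2)) ^ 2"
  proof -
    have "UNIV = {(j,k). j \<le> k + i} \<union> {(j,k). k + Suc i \<le> j}" by auto
    then have "fsum ?f UNIV = fsum ?f ({(j,k). j \<le> k + i} \<union> {(j,k). k + Suc i \<le> j})" by simp
    also have "\<dots> = fsum ?f {(j,k). j \<le> k + i} + Ycf (Suc i)"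
      unfolding Ycf_def by (rule fsum_Un_disjoint[OF l]) auto
    finally show ?thesis unfolding T ..
  qed
  ultimately show ?thesis by (simp only: distrib_left[symmetric])
qed

lemma rank_ge_Ycf:
  "(rank_ge (2 * i + 1) + rank_ge (2 * i + 2)) * (inverse (qinf 2)) ^ 2 = 2 * all_gf * Ycf (Suc i)"
proof -
  define v where "v i = rank_ge (2 * i + 1) + rank_ge (2 * i + 2)" for i
  define T where "T = (inverse (qinf 2)) ^ 2"
  define f where "f i = v i * T - 2 * all_gf * Ycf (Suc i)" for i
  have f_rec: "f i = - (fps_X ^ (2 * Suc i) * f (Suc i))" for i
  proof -
    have v: "v i = fps_X ^ (2 * Suc i) * (2 * all_gf - v (Suc i))"
      using rank_ge_recurrence[of "2 * i + 1"] by (simp add: v_def)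
    have Y: "Ycf (Suc i) = fps_X ^ (2 * Suc i) * T - fps_X ^ (2 * Suc i) * Ycf (Suc (Suc i))"
      using Ycf_recurrence[of "Suc i"] by (simp add: T_def algebra_simps)
    have "f i = fps_X ^ (2 * Suc i) * (2 * all_gf - v (Suc i)) * T
        - 2 * all_gf * (fps_X ^ (2 * Suc i) * T - fps_X ^ (2 * Suc i) * Ycf (Suc (Suc i)))"
      unfolding f_def v[symmetric] Y[symmetric] ..
    also have "\<dots> = - (fps_X ^ (2 * Suc i) * f (Suc i))"
      unfolding f_def by (simp add: algebra_simps)
    finally show ?thesis .
  qed
  have "fps_nth (f i) n = 0" for n i
  proof (induction n arbitrary: i rule: less_induct)
    case (less n)
    have "fps_nth (f i) n = - fps_nth (fps_X ^ (2 * Suc i) * f (Suc i)) n"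
      by (subst f_rec) (rule fps_neg_nth)
    also have "\<dots> = 0"
      unfolding fps_X_power_mult_nth using less[of "n - 2 * Suc i" "Suc i"] by simp
    finally show ?case .
  qed
  then have "f i = 0" by (simp add: fps_eq_iff)
  then show ?thesis by (simp add: f_def v_def T_def)
qed

lemma rank_ge_nth_eq_0:
  assumes "n \<le> i"
  shows "fps_nth (rank_ge (Suc i)) n = 0"
proof -
  have "overpartition_rank ps < int (Suc i)" if "overpartition_of n ps" for ps
  proof (cases ps)
    case (Cons q qs)
    then obtain a b where q: "ps = (a, b) # qs" by (metis surj_pair)
    have "a \<le> n" using overpartition_of_bounds(2)[OF that] q by force
    then show ?thesis using overpartition_rank_Cons that assms unfolding q by fastforce
  qed (simp add: overpartition_rank_def)
  then have "{ps. overpartition_of n ps \<and> overpartition_rank ps \<ge> int (Suc i)} = {}" by force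
  then show ?thesis by (simp only: rank_ge_def fps_nth_Abs_fps card.empty of_nat_0)
qed

lemma Nbar1_plus_eq_rank_ge: "Nbar1_plus n = fps_nth (fsum (\<lambda>i. rank_ge (Suc i)) UNIV) n"
proof -
  have fin: "finite {ps. overpartition_of n ps \<and> P ps}" for P
    by (rule finite_subset[OF _ finite_overpartitions[of n]]) auto
  have large: "overpartition_rank ps \<le> int n" if "overpartition_of n ps" for ps
  proof -
    have "card {ps. overpartition_of n ps \<and> overpartition_rank ps \<ge> int (Suc n)} = 0"
      using rank_ge_nth_eq_0[of n n] by (simp add: rank_ge_def)
    then show ?thesis using that fin by (auto simp: card_eq_0_iff)
  qed
  let ?S = "{ps. overpartition_of n ps}"
  have nbar: "real (Nbar m n) = (\<Sum>ps\<in>?S. if overpartition_rank ps = m then 1 else 0)" for m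
    unfolding Nbar_def by (subst sum.If_cases) (auto simp: finite_overpartitions Collect_conj_eq Int_commute)
  have rge: "fps_nth (rank_ge k) n = (\<Sum>ps\<in>?S. if overpartition_rank ps \<ge> int k then 1 else 0)" for k
    unfolding rank_ge_def by (subst sum.If_cases) (auto simp: finite_overpartitions Collect_conj_eq Int_commute)
  have "Nbar1_plus n = (\<Sum>\<^sub>\<infinity>m\<in>{1..int n}. of_int m * real (Nbar m n))"
    unfolding Nbar1_plus_def
  proof (rule infsum_cong_neutral)
    fix m assume "m \<in> {1..} - {1..int n}"
    then have "m > int n" by auto
    then have "{ps. overpartition_of n ps \<and> overpartition_rank ps = m} = {}" using large by fastforce
    then show "of_int m * real (Nbar m n) = 0"
      by (simp only: Nbar_def card.empty of_nat_0 mult_zero_right)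
  qed auto
  also have "\<dots> = (\<Sum>m\<in>{1..int n}. \<Sum>ps\<in>?S. if overpartition_rank ps = m then of_int m else 0)"
    by (simp add: nbar sum_distrib_left if_distrib cong: if_cong)
  also have "\<dots> = (\<Sum>ps\<in>?S. \<Sum>m\<in>{1..int n}. if overpartition_rank ps = m then of_int m else 0)"
    by (rule sum.swap)
  also have "\<dots> = (\<Sum>ps\<in>?S. \<Sum>i\<le>n. if overpartition_rank ps \<ge> int (Suc i) then 1 else 0)"
  proof (rule sum.cong[OF refl])
    fix ps assume "ps \<in> ?S"
    then have le: "overpartition_rank ps \<le> int n" using large by simp
    have "{i \<in> {..n}. overpartition_rank ps \<ge> int (Suc i)} = {..<nat (overpartition_rank ps)}"
      using le by auto
    then have "(\<Sum>i\<le>n. if overpartition_rank ps \<ge> int (Suc i) then 1 else 0) = real (nat (overpartition_rank ps))"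
      by (simp add: sum.inter_filter[symmetric])
    moreover have "(\<Sum>m\<in>{1..int n}. if overpartition_rank ps = m then of_int m else 0) = real (nat (overpartition_rank ps))"
      using le by (simp add: sum.delta) 
    ultimately show "(\<Sum>m\<in>{1..int n}. if overpartition_rank ps = m then of_int m else 0)
      = (\<Sum>i\<le>n. if overpartition_rank ps \<ge> int (Suc i) then 1 else (0::real))" by simp
  qed
  also have "\<dots> = (\<Sum>i\<le>n. fps_nth (rank_ge (Suc i)) n)"
    unfolding rge by (rule sum.swap)
  also have "\<dots> = fps_nth (fsum (\<lambda>i. rank_ge (Suc i)) UNIV) n"
    by (rule fsum_nat_nth[symmetric]) (simp add: rank_ge_nth_eq_0)
  finally show ?thesis .
qed

lemma fsum_pairs:
  fixes f :: "nat \<Rightarrow> real fps"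
  assumes "\<And>i n. n < i \<Longrightarrow> fps_nth (f i) n = 0"
  shows "fsum f UNIV = fsum (\<lambda>i. f (2 * i) + f (2 * i + 1)) UNIV"
proof (rule fps_ext)
  fix n
  have "(\<Sum>i<2 * m. fps_nth (f i) n) = (\<Sum>i<m. fps_nth (f (2 * i) + f (2 * i + 1)) n)" for m
    by (induction m) auto
  moreover have "fps_nth (fsum f UNIV) n = (\<Sum>i<2 * Suc n. fps_nth (f i) n)"
    by (rule fsum_nth) (use assms in auto)
  moreover have "fps_nth (fsum (\<lambda>i. f (2 * i) + f (2 * i + 1)) UNIV) n
      = (\<Sum>i<Suc n. fps_nth (f (2 * i) + f (2 * i + 1)) n)"
    by (rule fsum_nth) (use assms in auto)
  ultimately show "fps_nth (fsum f UNIV) n = fps_nth (fsum (\<lambda>i. f (2 * i) + f (2 * i + 1)) UNIV) n"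
    by simp
qed

lemma locfin_Ycf: "locfin (\<lambda>i. Ycf (Suc i)) UNIV"
  and fsum_Ycf: "fsum (\<lambda>i. Ycf (Suc i)) UNIV = ymoment"
proof -
  let ?f = "\<lambda>i (j,k). ecf 2 j * ecf 2 k"
  let ?S = "Sigma UNIV (\<lambda>i::nat. {(j,k). k + Suc i \<le> j})"
  have l: "locfin (\<lambda>(i,p). ?f i p) ?S"
  proof (rule locfinI[of _ "\<lambda>(i,(j,k)). j + k"])
    show "finite {q \<in> ?S. (case q of (i,(j,k)) \<Rightarrow> j + k) \<le> n}" for n
      by (rule finite_subset[of _ "{..n} \<times> ({..n} \<times> {..n})"]) auto
    fix q :: "nat \<times> nat \<times> nat" and n assume n: "n < (case q of (i,(j,k)) \<Rightarrow> j + k)"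
    obtain i j k where q: "q = (i,(j,k))" by (metis surj_pair)
    have "ecf 2 j * ecf 2 k = fps_X ^ (2 * j + 2 * k) * (iqf 2 j * iqf 2 k)"
      by (simp add: ecf_def power_add mult_ac)
    then show "fps_nth (case q of (i,p) \<Rightarrow> ?f i p) n = 0"
      using n by (simp add: q fps_X_power_mult_nth)
  qed
  show "locfin (\<lambda>i. Ycf (Suc i)) UNIV"
    unfolding Ycf_def by (rule locfin_Sigma_outer[OF l])
  define h where "h = (\<lambda>(p :: nat \<times> nat, i :: nat). (i, p))"
  have inj: "inj_on h A" for A by (auto simp: inj_on_def h_def)
  have im: "?S = h ` Sigma UNIV (\<lambda>(j,k). {..<j - k})"
    by (auto simp: h_def image_iff)
  have "fsum (\<lambda>i. Ycf (Suc i)) UNIV = fsum (\<lambda>(i,p). ?f i p) ?S"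
    unfolding Ycf_def by (rule fsum_Sigma[OF l, symmetric])
  also have "\<dots> = fsum (\<lambda>(p,i). ?f i p) (Sigma UNIV (\<lambda>(j,k). {..<j - k}))"
    unfolding im fsum_reindex[OF inj] by (simp add: h_def case_prod_unfold)
  also have "\<dots> = fsum (\<lambda>p. fsum (\<lambda>i. ?f i p) (case p of (j,k) \<Rightarrow> {..<j - k})) UNIV"
  proof (rule fsum_Sigma)
    from l show "locfin (\<lambda>(p,i). ?f i p) (Sigma UNIV (\<lambda>(j,k). {..<j - k}))"
      unfolding im locfin_reindex[OF inj] by (simp add: h_def case_prod_unfold)
  qed
  also have "\<dots> = ymoment"
    unfolding ymoment_def
    by (rule fsum_cong) (auto simp: fsum_finite fps_of_nat[symmetric])
  finally show "fsum (\<lambda>i. Ycf (Suc i)) UNIV = ymoment" .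
qed

lemma Nbar1_plus_eq: "Nbar1_plus n = fps_nth (qinf 2 * (2 * pinf ^ 2 * ymoment)) n"
proof -
  define N where "N = fsum (\<lambda>i. rank_ge (Suc i)) UNIV"
  define T where "T = (inverse (qinf 2)) ^ 2"
  have inv: "qinf 2 * inverse (qinf 2) = 1" by (rule inverse_mult_eq_1') simp
  have hT: "qinf 2 ^ 2 * T = 1"
    unfolding T_def power_mult_distrib[symmetric] inv by simp
  have N: "N = fsum (\<lambda>i. rank_ge (2 * i + 1) + rank_ge (2 * i + 2)) UNIV"
    unfolding N_def by (subst fsum_pairs) (simp_all add: rank_ge_nth_eq_0)
  have "locfin (\<lambda>i. rank_ge (2 * i + 1) + rank_ge (2 * i + 2)) UNIV"
    by (rule locfin_nat) (simp add: rank_ge_nth_eq_0 numeral_2_eq_2)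
  then have "N * T = fsum (\<lambda>i. (rank_ge (2 * i + 1) + rank_ge (2 * i + 2)) * T) UNIV"
    unfolding N by (rule fsum_mult_right[symmetric])
  also have "\<dots> = fsum (\<lambda>i. 2 * all_gf * Ycf (Suc i)) UNIV"
    unfolding T_def by (simp only: rank_ge_Ycf)
  also have "\<dots> = 2 * all_gf * ymoment"
    unfolding fsum_Ycf[symmetric] by (rule fsum_mult_left[OF locfin_Ycf])
  finally have NT: "N * T = 2 * all_gf * ymoment" .
  have "N = N * (qinf 2 ^ 2 * T)" by (simp add: hT)
  also have "\<dots> = qinf 2 ^ 2 * (N * T)" by (simp only: mult_ac)
  also have "\<dots> = qinf 2 * ((pinf * (all_gf * qinf 1)) * 2 * ymoment)"
    unfolding NT power2_eq_square by (subst (2) qinf_2) (simp only: mult_ac)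
  also have "\<dots> = qinf 2 * (2 * pinf ^ 2 * ymoment)"
    unfolding all_gf_eq power2_eq_square by (simp only: mult_ac)
  finally show ?thesis unfolding Nbar1_plus_eq_rank_ge N_def[symmetric] by simp
qed

theorem theorem1p1:
  fixes n :: nat
  assumes "n \<ge> 1"
  shows "Mbar1_plus n > Nbar1_plus n"
  using crank_excess_pos[OF assms]
  unfolding Mbar1_plus_eq Nbar1_plus_eq crank_moment_eq distrib_left by simp

end
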